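(* Suppose Assumptions 1 and 2 (listed in the context) hold, and let $\{w^k\}_{k\ge 0}=\{(u^k,v^k,p^k)\}_{k\ge0}$ be a sequence generated by the algorithm NAPP-AL (described in the context) where at every iteration $k$ one sets $$\delta_k := \beta \left(L_G+\|q^k\|L_{\Omega}+\gamma (L^0_{\Theta})^2+\frac{14\gamma\|B\|^2(L^0_{\Theta})^2}{\lambda_{\min}(B^{\top}B)}+\frac{14(L_G+\gamma\|B\| L^0_{\Theta})^2}{\gamma\lambda_{\min}(B^{\top}B)}+1\right)^{-1}.$$ Then, as $k\to\infty$, $$\min_{1\le j\le k}{\rm dist}\left(0,\partial\mathcal{L}_{\gamma}(w^j)\right)=o(1/\sqrt{k}).$$
   Context: Problem (P): minimize $F(u,v):=G(u,v)+J(u)+H(v)$ subject to $\Theta(u)+Bv=0$, $u\in\mathbf{U}$, $v\in\mathbf{R}^d$, where $\mathbf{U}\subseteq\mathbf{R}^n$ is nonempty, closed and convex, $\Theta=\Omega+\Phi:\mathbf{R}^n\to\mathbf{R}^m$ with $\Omega,\Phi$ differentiable, and $B\in\mathbf{R}^{m\times d}$. $\|\cdot\|$ is the Euclidean norm (spectral norm for matrices), $\lambda_{\min}$ the smallest eigenvalue, and ${\rm dist}(x,\mathbf{C})=\inf\{\|x-z\|:z\in \mathbf{C}\}$ ($+\infty$ if $\mathbf{C}=\emptyset$). Assumption 1. (H1) $G:\mathbf{R}^n\times\mathbf{R}^d\to\mathbf{R}$ is differentiable (possibly nonconvex) with $L_G$-Lipschitz gradient. (H2) $H:\mathbf{R}^d\to\mathbf{R}$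 is differentiable (possibly nonconvex) with $L_H$-Lipschitz gradient. (H3) $J:\mathbf{R}^n\to(-\infty,+\infty]$ is proper and lower semicontinuous (possibly nonconvex); if $\mathbf{U}=\mathbf{R}^n$, ${\rm dom}(J)$ is convex; if $\mathbf{U}\neq\mathbf{R}^n$, $J$ is locally Lipschitz continuous around every point of ${\rm dom}(J)\cap\mathbf{U}$. (H4) $\|\Theta(u)-\Theta(u')\|\le L^0_\Theta\|u-u'\|$ for all $u,u'$. (H5) $\Omega=(\Omega_1,\dots,\Omega_m)^\top$ where each $\Omega_j:\mathbf{R}^n\to\mathbf{R}$ has $L_{\Omega_j}$-Lipschitz gradient; $L_\Omega:=\sum_{j=1}^m L_{\Omega_j}$. (H6) $B$ is a tall matrix of full column rank and ${\rm Im}(\Theta)\subseteq{\rm Im}(B)$. (H7) $F$ is bounded below and coercive over $\{(u,v)\in\mathbf{R}^n\times\mathbf{R}^d:\Theta(u)+Bv=0\}$ (coercive: $F(u,v)\to+\infty$ as $\|(u,v)\|\to\infty$ within this set). Assumption 2. (i) $K:\mathbf{R}^n\to\mathbf{R}$ is differentiable, $\beta$-strongly convex ($\beta>0$), with $L_K$-Lipschitz gradient. (ii) $\gamma>\frac{\sqrt{57}+1}{2\lambda_{\min}(B^\top B)}(L_G+L_H)$ (and $\gamma>0$). Bregman distance: $D(u,u')=K(u)-K(u')-\langle\nabla K(u'),u-u'\rangle$. Algorithm NAPP-AL. Fix $\sigma\in(0,1)$ and start from $u^0\in\mathbf{R}^n,v^0\in\mathbf{R}^d,p^0\in\mathbf{R}^m$.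 For $k=0,1,2,\dots$: set $q^k=p^k+\gamma(\Theta(u^k)+Bv^k)$, take $\delta_k>0$ and $\epsilon^k$ with $\sigma\delta_k\le\epsilon^k\le\delta_k$, and let $$u^{k+1}\in\arg\min_{u\in\mathbf{U}}\ \langle\nabla_uG(u^k,v^k),u\rangle+J(u)+\langle q^k,\nabla\Omega(u^k)u+\Phi(u)\rangle+\tfrac1{\epsilon^k}D(u,u^k),$$ $$v^{k+1}=\arg\min_{v\in\mathbf{R}^d}\ \langle\nabla_vG(u^k,v^k)+\nabla H(v^k),v\rangle+\langle q^k,Bv\rangle+\tfrac\gamma2\|B(v-v^k)\|^2,$$ $$p^{k+1}=p^k+\gamma(\Theta(u^{k+1})+Bv^{k+1}).$$ The $u$-subproblem is assumed to be solved to global optimality (a global minimizer is assumed to exist). Write $w^k=(u^k,v^k,p^k)$. Augmented Lagrangian: for $w=(u,v,p)$, $\mathcal{L}_\gamma(w)=F(u,v)+\langle p,\Theta(u)+Bv\rangle+\frac\gamma2\|\Theta(u)+Bv\|^2$. For $w\in\mathbf{U}\times\mathbf{R}^d\times\mathbf{R}^m$, $\partial\mathcal{L}_\gamma(w)$ denotes the product of the three sets $\nabla_uG(u,v)+\partial J(u)+\mathcal{N}_{\mathbf{U}}(u)+(\nabla\Theta(u))^\top[p+\gamma(\Theta(u)+Bv)]$, $\{\nabla_vG(u,v)+\nabla H(v)+B^\top[p+\gamma(\Theta(u)+Bv)]\}$, $\{\Theta(u)+Bv\}$, where $\partial J$ is the limiting (Mordukhovich) subdifferential and $\mathcal{N}_{\mathbf{U}}(u)=\{\xi:\langle\xi,\zeta-u\rangle\le0\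 \forall\zeta\in\mathbf{U}\}$. *)

theory Defs
  imports "HOL-Analysis.Analysis" "HOL-Library.Landau_Symbols"
begin

text \<open>
  Extended-real valued functions have type \<open>'a \<Rightarrow> ereal\<close>; the codomain is restricted to
  \<open>(-\<infinity>, +\<infinity>]\<close> by \<open>proper\<close>. Points \<open>(u, v)\<close> live in a product type, whose norm is the Euclidean
  norm of the concatenated vector.
\<close>

definition grad :: "('a::real_inner \<Rightarrow> real) \<Rightarrow> 'a \<Rightarrow> 'a" where
  "grad f x = (THE D. GDERIV f x :> D)"

definition eff_dom :: "('a \<Rightarrow> ereal) \<Rightarrow> 'a set" where
  "eff_dom f = {x. f x < \<infinity>}"

definition proper :: "('a \<Rightarrow> ereal) \<Rightarrow> bool" where
  "proper f \<longleftrightarrow> (\<forall>x. f x \<noteq> -\<infinity>) \<and> eff_dom f \<noteq> {}"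

definition lower_semicontinuous :: "('a::topological_space \<Rightarrow> ereal) \<Rightarrow> bool" where
  "lower_semicontinuous f \<longleftrightarrow> (\<forall>x. f x \<le> Liminf (at x) f)"

text \<open>Local Lipschitz continuity around \<open>x\<close> includes finiteness on a full neighbourhood of \<open>x\<close>.\<close>

definition locally_lipschitz_around :: "('a::metric_space \<Rightarrow> ereal) \<Rightarrow> 'a \<Rightarrow> bool" where
  "locally_lipschitz_around f x \<longleftrightarrow>
     (\<exists>r>0. \<exists>L. (\<forall>y\<in>ball x r. \<bar>f y\<bar> \<noteq> \<infinity>) \<and>
                L-lipschitz_on (ball x r) (\<lambda>y. real_of_ereal (f y)))"

definition strongly_convex :: "real \<Rightarrow> ('a::real_normed_vector \<Rightarrow> real) \<Rightarrow> bool" where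
  "strongly_convex \<beta> f \<longleftrightarrow>
     (\<forall>x y. \<forall>t\<in>{0..1}. f (t *\<^sub>R x + (1 - t) *\<^sub>R y)
        \<le> t * f x + (1 - t) * f y - \<beta> / 2 * t * (1 - t) * (norm (x - y))\<^sup>2)"

definition coercive_on :: "'a::real_normed_vector set \<Rightarrow> ('a \<Rightarrow> ereal) \<Rightarrow> bool" where
  "coercive_on S f \<longleftrightarrow> (f \<longlongrightarrow> \<infinity>) (inf at_infinity (principal S))"

definition lambda_min :: "real^'n^'n \<Rightarrow> real" where
  "lambda_min A = Min {l. \<exists>x. x \<noteq> 0 \<and> A *v x = l *\<^sub>R x}"

definition bregman :: "('a::real_inner \<Rightarrow> real) \<Rightarrow> 'a \<Rightarrow> 'a \<Rightarrow> real" where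
  "bregman K x y = K x - K y - grad K y \<bullet> (x - y)"

text \<open>The distance to the empty set is \<open>\<infinity>\<close>, unlike for the library's \<open>infdist\<close>.\<close>

definition edist :: "'a::metric_space \<Rightarrow> 'a set \<Rightarrow> ereal" where
  "edist x C = (INF z\<in>C. ereal (dist x z))"

definition normal_cone :: "'a::real_inner set \<Rightarrow> 'a \<Rightarrow> 'a set" where
  "normal_cone U x = {\<xi>. \<forall>z\<in>U. \<xi> \<bullet> (z - x) \<le> 0}"

definition frechet_subdiff :: "('a::real_inner \<Rightarrow> ereal) \<Rightarrow> 'a \<Rightarrow> 'a set" where
  "frechet_subdiff f x =
     {\<xi>. \<bar>f x\<bar> \<noteq> \<infinity> \<and>
         0 \<le> Liminf (at x) (\<lambda>y. (f y - f x - ereal (\<xi> \<bullet> (y - x))) / ereal (norm (y - x)))}"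

text \<open>The limiting (Mordukhovich) subdifferential, with \<open>f\<close>-attentive convergence of the base points.\<close>

definition limiting_subdiff :: "('a::real_inner \<Rightarrow> ereal) \<Rightarrow> 'a \<Rightarrow> 'a set" where
  "limiting_subdiff f x =
     {\<xi>. \<bar>f x\<bar> \<noteq> \<infinity> \<and>
         (\<exists>y \<eta>. y \<longlonglongrightarrow> x \<and> (\<lambda>k. f (y k)) \<longlonglongrightarrow> f x \<and> \<eta> \<longlonglongrightarrow> \<xi> \<and>
                (\<forall>k. \<eta> k \<in> frechet_subdiff f (y k)))}"

definition objective ::
  "('a \<times> 'b \<Rightarrow> real) \<Rightarrow> ('a \<Rightarrow> ereal) \<Rightarrow> ('b \<Rightarrow> real) \<Rightarrow> 'a \<times> 'b \<Rightarrow> ereal" where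
  "objective G J H = (\<lambda>(u, v). ereal (G (u, v)) + J u + ereal (H v))"

text \<open>
  The subdifferential of the augmented Lagrangian
  \<open>objective G J H (u, v) + p \<bullet> (\<Theta> u + B *v v) + \<gamma> / 2 * (norm (\<Theta> u + B *v v))\<^sup>2\<close>
  over \<open>U \<times> UNIV \<times> UNIV\<close>, as the product of its three components.
\<close>

definition al_subdiff ::
  "((real^'n) \<times> (real^'d) \<Rightarrow> real) \<Rightarrow> (real^'n \<Rightarrow> ereal) \<Rightarrow> (real^'d \<Rightarrow> real) \<Rightarrow>
   (real^'n \<Rightarrow> real^'m) \<Rightarrow> real^'d^'m \<Rightarrow> (real^'n) set \<Rightarrow> real \<Rightarrow>
   (real^'n) \<times> (real^'d) \<times> (real^'m) \<Rightarrow> ((real^'n) \<times> (real^'d) \<times> (real^'m)) set" where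
  "al_subdiff G J H \<Theta> B U \<gamma> = (\<lambda>(u, v, p).
     {grad (\<lambda>u'. G (u', v)) u + \<xi> + \<nu>
        + transpose (jacobian \<Theta> (at u)) *v (p + \<gamma> *\<^sub>R (\<Theta> u + B *v v)) | \<xi> \<nu>.
        \<xi> \<in> limiting_subdiff J u \<and> \<nu> \<in> normal_cone U u}
     \<times> {grad (\<lambda>v'. G (u, v')) v + grad H v + transpose B *v (p + \<gamma> *\<^sub>R (\<Theta> u + B *v v))}
     \<times> {\<Theta> u + B *v v})"

text \<open>
  The sequences \<open>u\<close>, \<open>v\<close>, \<open>p\<close> (with the auxiliary \<open>q\<close>, \<open>\<delta>\<close>, \<open>\<epsilon>\<close>) form a run of NAPP-AL.
  As usual for extended-real valued objectives, a point counts as a minimizer of the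
  \<open>u\<close>-subproblem only if the objective is finite there.
\<close>

definition napp_al ::
  "((real^'n) \<times> (real^'d) \<Rightarrow> real) \<Rightarrow> (real^'n \<Rightarrow> ereal) \<Rightarrow> (real^'d \<Rightarrow> real) \<Rightarrow>
   (real^'n \<Rightarrow> real^'m) \<Rightarrow> (real^'n \<Rightarrow> real^'m) \<Rightarrow> real^'d^'m \<Rightarrow> (real^'n) set \<Rightarrow>
   (real^'n \<Rightarrow> real) \<Rightarrow> real \<Rightarrow> real \<Rightarrow> (nat \<Rightarrow> real) \<Rightarrow> (nat \<Rightarrow> real) \<Rightarrow> (nat \<Rightarrow> real^'m) \<Rightarrow>
   (nat \<Rightarrow> real^'n) \<Rightarrow> (nat \<Rightarrow> real^'d) \<Rightarrow> (nat \<Rightarrow> real^'m) \<Rightarrow> bool" where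
  "napp_al G J H \<Omega> \<Phi> B U K \<gamma> \<sigma> \<delta> \<epsilon> q u v p \<longleftrightarrow> (\<forall>k.
     let \<Theta> = (\<lambda>x. \<Omega> x + \<Phi> x);
         u_obj = (\<lambda>x. ereal (grad (\<lambda>u'. G (u', v k)) (u k) \<bullet> x) + J x
                   + ereal (q k \<bullet> (jacobian \<Omega> (at (u k)) *v x + \<Phi> x)
                            + 1 / \<epsilon> k * bregman K x (u k)));
         v_obj = (\<lambda>y. (grad (\<lambda>v'. G (u k, v')) (v k) + grad H (v k)) \<bullet> y + q k \<bullet> (B *v y)
                   + \<gamma> / 2 * (norm (B *v (y - v k)))\<^sup>2)
     in q k = p k + \<gamma> *\<^sub>R (\<Theta> (u k) + B *v v k) \<and>
        \<delta> k > 0 \<and> \<sigma> * \<delta> k \<le> \<epsilon> k \<and> \<epsilon> k \<le> \<delta> k \<and>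
        is_arg_min u_obj (\<lambda>x. x \<in> U) (u (Suc k)) \<and> u_obj (u (Suc k)) < \<infinity> \<and>
        is_arg_min v_obj (\<lambda>y. True) (v (Suc k)) \<and>
        p (Suc k) = p k + \<gamma> *\<^sub>R (\<Theta> (u (Suc k)) + B *v v (Suc k)))"

end

theory Submission
  imports Defs
begin

text \<open>
  Optimality of the \<open>v\<close>-step expresses \<open>transpose B *v p\<close> through gradients at the previous iterate.
  Since the multiplier increments lie in the range of \<open>B\<close>, they are therefore controlled by the
  increments of \<open>u\<close> and \<open>v\<close>, and the augmented Lagrangian plus suitable multiples of the squared
  increments is a Lyapunov function whose decrease dominates the squared increments. It is bounded
  below by the objective at a feasible point sharing the component \<open>u k\<close>, so the squared increments are summable,
  and coercivity bounds the iterates, hence \<open>q k\<close> and \<open>1 / \<epsilon> k\<close>. Fermat's rule for the \<open>u\<close>-step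
  then yields an element of the subdifferential at step \<open>k + 1\<close> of size at most a constant times the
  increments; the running minimum of a square-summable sequence is \<open>o(1 / sqrt k)\<close>.
\<close>

text \<open>The dependence of \<open>\<delta> k\<close> on \<open>norm (q k)\<close> shapes the
  order of the argument: no bound on the multipliers may be assumed before the descent. Since
  \<open>\<beta> / \<epsilon> k\<close> is at least \<open>\<beta> / \<delta> k\<close>, its summand
  \<open>norm (q k) * L_Omega\<close> absorbs the linearization error of \<open>\<Omega>\<close>,
  however large \<open>q k\<close> is. Only afterwards is \<open>q\<close> shown to be bounded,
  which keeps \<open>\<epsilon> k\<close> away from 0. The summands of
  \<open>\<beta> / \<delta> k\<close> enter the descent halved, so each constant 14 becomes a 7. Of
  the 7 multiples of \<open>N\<^sup>2 / (\<gamma> * lam)\<close>, 4 pay for the change of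
  \<open>\<Theta>\<close> in the penalty and 3 for the multiplier step; the 7 multiples of
  \<open>M\<^sup>2 / (\<gamma> * lam)\<close> supply the 3 that the Lyapunov function adds. The
  summand 1 leaves the net decrease \<open>1 / 2 * (du k)\<^sup>2\<close>. The start is arbitrary:
  \<open>u 0\<close> may lie outside \<open>U\<close> or have infinite \<open>J\<close>. The
  Lyapunov function therefore starts from the augmented Lagrangian at index 1.\<close>

subsection \<open>Gradients and Jacobians\<close>

text \<open>As a simp rule it turns \<open>transpose B *v y\<close> into \<open>y v* B\<close>,
  which hides these terms from the linearity rules for \<open>*v\<close>.\<close>

declare transpose_matrix_vector [simp del]

lemma GDERIV_unique: "GDERIV f x :> D \<Longrightarrow> GDERIV f x :> D' \<Longrightarrow> D = D'"
  for D :: "'a::real_inner"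
proof -
  assume "GDERIV f x :> D" "GDERIV f x :> D'"
  then have "(\<lambda>h. h \<bullet> D) = (\<lambda>h. h \<bullet> D')"
    unfolding gderiv_def by (rule has_derivative_unique)
  then have "(D - D') \<bullet> D = (D - D') \<bullet> D'" by meson
  then show "D = D'" by (metis inner_diff_right inner_eq_zero_iff right_minus_eq)
qed

lemma grad_eqI: "GDERIV f x :> D \<Longrightarrow> grad f x = D"
  unfolding grad_def using GDERIV_unique by blast

lemma GDERIV_grad:
  fixes f :: "'a::euclidean_space \<Rightarrow> real"
  assumes "f differentiable at x"
  shows "GDERIV f x :> grad f x"
proof -
  obtain f' where f': "(f has_derivative f') (at x)"
    using assms unfolding differentiable_def by blast
  then have "linear f'" by (rule has_derivative_linear)
  from adjoint_works[OF this, of _ 1] have "f' = (\<lambda>h. h \<bullet> adjoint f' 1)" by (simp add: fun_eq_iff)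
  with f' have "GDERIV f x :> adjoint f' 1" by (simp add: gderiv_def)
  then show ?thesis using grad_eqI by metis
qed

lemma GDERIV_partial_fst:
  fixes f :: "'a::euclidean_space \<times> 'b::euclidean_space \<Rightarrow> real"
  assumes "f differentiable at (x, y)"
  shows "GDERIV (\<lambda>a. f (a, y)) x :> fst (grad f (x, y))"
proof -
  have "(f has_derivative (\<lambda>h. h \<bullet> grad f (x, y))) (at ((\<lambda>a. (a, y)) x))"
    using GDERIV_grad[OF assms] by (simp add: gderiv_def)
  moreover have "((\<lambda>a. (a, y)) has_derivative (\<lambda>h. (h, 0))) (at x)"
    by (auto intro!: derivative_eq_intros)
  ultimately have "((\<lambda>a. f (a, y)) has_derivative (\<lambda>h. (h, 0) \<bullet> grad f (x, y))) (at x)"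
    by (rule has_derivative_compose[rotated])
  then show ?thesis by (simp add: gderiv_def inner_prod_def)
qed

lemma GDERIV_partial_snd:
  fixes f :: "'a::euclidean_space \<times> 'b::euclidean_space \<Rightarrow> real"
  assumes "f differentiable at (x, y)"
  shows "GDERIV (\<lambda>b. f (x, b)) y :> snd (grad f (x, y))"
proof -
  have "(f has_derivative (\<lambda>h. h \<bullet> grad f (x, y))) (at ((\<lambda>b. (x, b)) y))"
    using GDERIV_grad[OF assms] by (simp add: gderiv_def)
  moreover have "((\<lambda>b. (x, b)) has_derivative (\<lambda>h. (0, h))) (at y)"
    by (auto intro!: derivative_eq_intros)
  ultimately have "((\<lambda>b. f (x, b)) has_derivative (\<lambda>h. (0, h) \<bullet> grad f (x, y))) (at y)"
    by (rule has_derivative_compose[rotated])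
  then show ?thesis by (simp add: gderiv_def inner_prod_def)
qed

lemma GDERIV_eq_zero_if_minimum:
  fixes f :: "'a::real_inner \<Rightarrow> real"
  assumes "GDERIV f x :> D" "open S" "x \<in> S" "\<And>y. y \<in> S \<Longrightarrow> f x \<le> f y"
  shows "D = 0"
proof -
  have "(\<lambda>h. h \<bullet> D) = (\<lambda>v. 0)"
    using differential_zero_maxmin[of x S f "\<lambda>h. h \<bullet> D"] assms by (auto simp: gderiv_def)
  then have "D \<bullet> D = 0" by meson
  then show ?thesis by simp
qed

section \<open>Quadratic bounds from Lipschitz gradients and strong convexity\<close>

text \<open>Along the segment from \<open>x\<close> to \<open>y\<close>, the gap
  \<open>\<phi>\<close> between \<open>f\<close> and its quadratic model has nonpositive derivative,
  because the Lipschitz bound on the gradient at parameter \<open>t\<close> is exactly the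
  derivative of the quadratic term. Monotonicity replaces integration.\<close>

lemma descent_lemma:
  fixes f :: "'a::real_inner \<Rightarrow> real"
  assumes der: "\<And>z. GDERIV f z :> g z" and lip: "L-lipschitz_on UNIV g"
  shows "f y \<le> f x + g x \<bullet> (y - x) + L / 2 * (norm (y - x))\<^sup>2"
proof -
  define h where "h = y - x"
  define \<phi> where "\<phi> t = f (x + t *\<^sub>R h) - t * (g x \<bullet> h) - L / 2 * t\<^sup>2 * (norm h)\<^sup>2" for t
  have D: "DERIV \<phi> t :> (g (x + t *\<^sub>R h) - g x) \<bullet> h - L * t * (norm h)\<^sup>2" for t
  proof -
    have "(f has_derivative (\<lambda>a. a \<bullet> g (x + t *\<^sub>R h))) (at ((\<lambda>t. x + t *\<^sub>R h) t))"
      using der by (simp add: gderiv_def)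
    moreover have "((\<lambda>t. x + t *\<^sub>R h) has_derivative (\<lambda>s. s *\<^sub>R h)) (at t)"
      by (auto intro!: derivative_eq_intros)
    ultimately have "((\<lambda>t. f (x + t *\<^sub>R h)) has_derivative (\<lambda>s. (s *\<^sub>R h) \<bullet> g (x + t *\<^sub>R h))) (at t)"
      by (rule has_derivative_compose[rotated])
    then have "DERIV (\<lambda>t. f (x + t *\<^sub>R h)) t :> h \<bullet> g (x + t *\<^sub>R h)"
      by (simp add: has_field_derivative_def mult.commute[of _ "h \<bullet> g (x + t *\<^sub>R h)"])
    then have "DERIV \<phi> t :> h \<bullet> g (x + t *\<^sub>R h) - g x \<bullet> h - L / 2 * (2 * t) * (norm h)\<^sup>2"
      unfolding \<phi>_def by (auto intro!: derivative_eq_intros)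
    then show ?thesis by (simp add: inner_diff_left inner_diff_right inner_commute)
  qed
  have "\<phi> 1 \<le> \<phi> 0"
  proof (rule DERIV_nonpos_imp_nonincreasing[of 0 1 \<phi>])
    fix t :: real assume t: "0 \<le> t" "t \<le> 1"
    have "(g (x + t *\<^sub>R h) - g x) \<bullet> h \<le> norm (g (x + t *\<^sub>R h) - g x) * norm h"
      by (rule norm_cauchy_schwarz)
    also have "\<dots> \<le> (L * norm (t *\<^sub>R h)) * norm h"
      using lipschitz_onD[OF lip, of "x + t *\<^sub>R h" x]
      by (intro mult_right_mono) (auto simp: dist_norm)
    also have "\<dots> = L * t * (norm h)\<^sup>2" using t by (simp add: power2_eq_square)
    finally show "\<exists>y. DERIV \<phi> t :> y \<and> y \<le> 0" using D[of t] by fastforce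
  qed simp
  then show ?thesis by (simp add: \<phi>_def h_def)
qed

lemma descent_lemma_abs:
  fixes f :: "'a::real_inner \<Rightarrow> real"
  assumes der: "\<And>z. GDERIV f z :> g z" and lip: "L-lipschitz_on UNIV g"
  shows "\<bar>f y - f x - g x \<bullet> (y - x)\<bar> \<le> L / 2 * (norm (y - x))\<^sup>2"
proof -
  have "GDERIV (\<lambda>z. - f z) z :> - g z" for z
    using der[of z] by (auto simp: gderiv_def intro!: derivative_eq_intros)
  moreover have "L-lipschitz_on UNIV (\<lambda>z. - g z)" using lip by simp
  ultimately have "- f y \<le> - f x + - g x \<bullet> (y - x) + L / 2 * (norm (y - x))\<^sup>2"
    by (rule descent_lemma)
  with descent_lemma[OF der lip, of y x] show ?thesis
    by (simp only: inner_minus_left abs_le_iff) linarith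
qed

text \<open>Dividing the strong convexity inequality at \<open>y + t *\<^sub>R h\<close> by
  \<open>t\<close> and letting \<open>t\<close> tend to 0 from the right turns the difference
  quotient into the directional derivative.\<close>

lemma strongly_convex_imp_bregman_ge:
  fixes K :: "'a::euclidean_space \<Rightarrow> real"
  assumes sc: "strongly_convex \<beta> K" and diff: "K differentiable at y"
  shows "\<beta> / 2 * (norm (x - y))\<^sup>2 \<le> bregman K x y"
proof -
  define h where "h = x - y"
  have "GDERIV K y :> grad K y" by (rule GDERIV_grad[OF diff])
  then have "(K has_derivative (\<lambda>a. a \<bullet> grad K y)) (at ((\<lambda>t. y + t *\<^sub>R h) 0))"
    by (simp add: gderiv_def)
  moreover have "((\<lambda>t. y + t *\<^sub>R h) has_derivative (\<lambda>s. s *\<^sub>R h)) (at (0::real))"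
    by (auto intro!: derivative_eq_intros)
  ultimately have "((\<lambda>t. K (y + t *\<^sub>R h)) has_derivative (\<lambda>s. (s *\<^sub>R h) \<bullet> grad K y)) (at (0::real))"
    by (rule has_derivative_compose[rotated])
  then have "DERIV (\<lambda>t. K (y + t *\<^sub>R h)) 0 :> h \<bullet> grad K y"
    by (simp add: has_field_derivative_def mult.commute[of _ "h \<bullet> grad K y"])
  then have "((\<lambda>t. (K (y + t *\<^sub>R h) - K y) / t) \<longlongrightarrow> h \<bullet> grad K y) (at 0)"
    by (simp add: has_field_derivative_iff)
  then have lim: "((\<lambda>t. (K (y + t *\<^sub>R h) - K y) / t) \<longlongrightarrow> h \<bullet> grad K y) (at_right 0)"
    by (rule filterlim_mono) (auto simp: at_le)
  have lim2: "((\<lambda>t. K x - K y - \<beta> / 2 * (1 - t) * (norm h)\<^sup>2) \<longlongrightarrow>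
      K x - K y - \<beta> / 2 * (1 - 0) * (norm h)\<^sup>2) (at_right 0)"
    by (intro tendsto_intros)
  have "h \<bullet> grad K y \<le> K x - K y - \<beta> / 2 * (1 - 0) * (norm h)\<^sup>2"
  proof (rule tendsto_le[OF _ lim2 lim])
    have "\<forall>\<^sub>F t in at_right 0. t \<in> {0<..<1::real}" by (rule eventually_at_right_real) simp
    then show "\<forall>\<^sub>F t in at_right 0. (K (y + t *\<^sub>R h) - K y) / t
        \<le> K x - K y - \<beta> / 2 * (1 - t) * (norm h)\<^sup>2"
    proof eventually_elim
      case (elim t)
      have "K (t *\<^sub>R x + (1 - t) *\<^sub>R y)
          \<le> t * K x + (1 - t) * K y - \<beta> / 2 * t * (1 - t) * (norm (x - y))\<^sup>2"
        using sc elim unfolding strongly_convex_def by simp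
      moreover have "t *\<^sub>R x + (1 - t) *\<^sub>R y = y + t *\<^sub>R h"
        by (simp add: h_def algebra_simps)
      ultimately have "K (y + t *\<^sub>R h) - K y
          \<le> t * (K x - K y - \<beta> / 2 * (1 - t) * (norm h)\<^sup>2)"
        by (simp add: h_def algebra_simps)
      then show ?case using elim by (simp add: divide_le_eq mult.commute)
    qed
  qed simp
  then show ?thesis by (simp add: bregman_def h_def inner_commute)
qed

section \<open>Norm bounds for a matrix and its transpose, and the least eigenvalue\<close>

lemma norm_transpose_mult_le:
  fixes B :: "real^'d^'m"
  shows "norm (transpose B *v y) \<le> onorm ((*v) B) * norm y"
proof -
  have "(norm (transpose B *v y))\<^sup>2 = (B *v (transpose B *v y)) \<bullet> y"
    by (metis dot_lmul_matrix inner_commute power2_norm_eq_inner transpose_matrix_vector)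
  also have "\<dots> \<le> norm (B *v (transpose B *v y)) * norm y"
    by (rule norm_cauchy_schwarz)
  also have "\<dots> \<le> onorm ((*v) B) * norm (transpose B *v y) * norm y"
    by (intro mult_right_mono onorm) auto
  finally have *: "norm (transpose B *v y) * norm (transpose B *v y)
      \<le> norm (transpose B *v y) * (onorm ((*v) B) * norm y)"
    by (simp add: power2_eq_square algebra_simps)
  show ?thesis
  proof (cases "norm (transpose B *v y) = 0")
    case True
    then show ?thesis using onorm_pos_le[of "(*v) B"] by simp
  next
    case False
    then show ?thesis using * mult_le_cancel_left_pos norm_ge_zero by (metis order_le_less)
  qed
qed

text \<open>\<open>lambda_min\<close> is a \<open>Min\<close>, which is meaningful only for a finite
  nonempty set. Eigenvectors of distinct eigenvalues are orthogonal, hence independent, hence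
  finitely many.\<close>

lemma finite_eigenvalues_symmetric:
  fixes A :: "real^'n^'n"
  assumes sym: "transpose A = A"
  shows "finite {l. \<exists>x. x \<noteq> 0 \<and> A *v x = l *\<^sub>R x}" (is "finite ?E")
proof -
  have "\<forall>l\<in>?E. \<exists>x. x \<noteq> 0 \<and> A *v x = l *\<^sub>R x" by blast
  then obtain e where e: "\<And>l. l \<in> ?E \<Longrightarrow> e l \<noteq> 0 \<and> A *v e l = l *\<^sub>R e l"
    unfolding bchoice_iff by blast
  have orth: "e l \<bullet> e l' = 0" if "l \<in> ?E" "l' \<in> ?E" "l \<noteq> l'" for l l'
  proof -
    have "l * (e l \<bullet> e l') = (A *v e l) \<bullet> e l'" using e[OF that(1)] by simp
    also have "\<dots> = e l \<bullet> (A *v e l')" by (metis dot_lmul_matrix sym transpose_matrix_vector)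
    also have "\<dots> = l' * (e l \<bullet> e l')" using e[OF that(2)] by simp
    finally show ?thesis using that(3) by simp
  qed
  have inj: "inj_on e ?E"
  proof (intro inj_onI, rule ccontr)
    fix l l' assume l: "l \<in> ?E" "l' \<in> ?E" "e l = e l'" "l \<noteq> l'"
    have "e l \<bullet> e l = 0" using orth[OF l(1,2,4)] unfolding l(3)[symmetric] .
    then show False using e[OF l(1)] by simp
  qed
  have "pairwise orthogonal (e ` ?E)"
    unfolding pairwise_def orthogonal_def using orth by blast
  moreover have "0 \<notin> e ` ?E" using e by force
  ultimately have "independent (e ` ?E)" by (rule pairwise_orthogonal_independent)
  then have "finite (e ` ?E)" by (rule independent_imp_finite)
  then show ?thesis using inj by (rule finite_imageD)
qed

text \<open>The Rayleigh quotient attains its minimum \<open>\<mu>\<close> on the compact unit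
  sphere. Stationarity makes \<open>\<mu>\<close> an eigenvalue, and every eigenvalue is a value of
  the quotient, so \<open>\<mu>\<close> is the least one.\<close>

lemma
  fixes B :: "real^'d^'m"
  defines "l \<equiv> lambda_min (transpose B ** B)"
  shows lambda_min_le: "l * (norm x)\<^sup>2 \<le> (norm (B *v x))\<^sup>2"
    and lambda_min_pos: "inj ((*v) B) \<Longrightarrow> 0 < l"
proof -
  have BB: "((transpose B ** B) *v x) \<bullet> y = (B *v x) \<bullet> (B *v y)" for x y
    by (metis dot_lmul_matrix matrix_vector_mul_assoc transpose_matrix_vector)
  let ?E = "{l. \<exists>x. x \<noteq> 0 \<and> (transpose B ** B) *v x = l *\<^sub>R x}"
  have "\<exists>x\<in>sphere (0::real^'d) 1. \<forall>y\<in>sphere 0 1. (norm (B *v x))\<^sup>2 \<le> (norm (B *v y))\<^sup>2"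
  proof (rule continuous_attains_inf)
    show "sphere (0::real^'d) 1 \<noteq> {}" by (metis norm_axis_1 mem_sphere_0 empty_iff)
    show "continuous_on (sphere 0 1) (\<lambda>x. (norm (B *v x))\<^sup>2)"
      by (intro continuous_intros matrix_vector_mult_linear_continuous_on)
  qed simp
  then obtain e where e: "norm e = 1" "\<And>y. norm y = 1 \<Longrightarrow> (norm (B *v e))\<^sup>2 \<le> (norm (B *v y))\<^sup>2"
    by auto
  define \<mu> where "\<mu> = (norm (B *v e))\<^sup>2"
  have ray: "\<mu> * (norm x)\<^sup>2 \<le> (norm (B *v x))\<^sup>2" for x
  proof (cases "x = 0")
    case False
    have "\<mu> \<le> (norm (B *v ((1 / norm x) *\<^sub>R x)))\<^sup>2"
      unfolding \<mu>_def by (rule e(2)) (use False in simp)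
    also have "\<dots> = (norm (B *v x))\<^sup>2 / (norm x)\<^sup>2"
      by (simp add: matrix_vector_mult_scaleR power_divide)
    finally show ?thesis using False by (simp add: field_simps)
  qed simp
  \<comment> \<open>By \<open>ray\<close> this function is nonnegative everywhere and it vanishes at
    \<open>e\<close>, so \<open>e\<close> is an unconstrained minimizer and no Lagrange multiplier
    for the sphere is required.\<close>
  have deriv: "GDERIV (\<lambda>x. (norm (B *v x))\<^sup>2 - \<mu> * (norm x)\<^sup>2) e :>
      2 *\<^sub>R ((transpose B ** B) *v e - \<mu> *\<^sub>R e)"
  proof -
    have d: "((\<lambda>x. B *v x) has_derivative (\<lambda>x. B *v x)) (at e)"
      by (rule bounded_linear.has_derivative[OF matrix_vector_mul_bounded_linear]) auto
    have "((\<lambda>x. (B *v x) \<bullet> (B *v x) - \<mu> * (x \<bullet> x)) has_derivative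
      (\<lambda>h. ((B *v e) \<bullet> (B *v h) + (B *v h) \<bullet> (B *v e)) - \<mu> * (e \<bullet> h + h \<bullet> e))) (at e)"
      by (auto intro!: derivative_eq_intros d)
    moreover have "(\<lambda>h. ((B *v e) \<bullet> (B *v h) + (B *v h) \<bullet> (B *v e)) - \<mu> * (e \<bullet> h + h \<bullet> e))
       = (\<lambda>h. h \<bullet> (2 *\<^sub>R ((transpose B ** B) *v e - \<mu> *\<^sub>R e)))"
      using BB by (simp add: fun_eq_iff inner_diff_right inner_commute algebra_simps)
    ultimately show ?thesis by (simp add: gderiv_def power2_norm_eq_inner)
  qed
  have "2 *\<^sub>R ((transpose B ** B) *v e - \<mu> *\<^sub>R e) = 0"
    by (rule GDERIV_eq_zero_if_minimum[OF deriv, of UNIV]) (use ray e(1) in \<open>auto simp: \<mu>_def\<close>)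
  then have "(transpose B ** B) *v e = \<mu> *\<^sub>R e" by simp
  moreover have "e \<noteq> 0" using e(1) by auto
  ultimately have mem: "\<mu> \<in> ?E" by blast
  have low: "\<mu> \<le> l" if "l \<in> ?E" for l
  proof -
    from that obtain x where x: "x \<noteq> 0" "(transpose B ** B) *v x = l *\<^sub>R x" by blast
    have "\<mu> * (norm x)\<^sup>2 \<le> l * (norm x)\<^sup>2"
      using ray[of x] BB[of x x] x(2) by (simp add: power2_norm_eq_inner)
    then show ?thesis using x(1) by simp
  qed
  have "finite ?E"
    by (rule finite_eigenvalues_symmetric) (simp add: matrix_transpose_mul)
  then have l: "l = \<mu>"
    unfolding l_def lambda_min_def using mem low by (intro Min_eqI) auto
  show "l * (norm x)\<^sup>2 \<le> (norm (B *v x))\<^sup>2" using ray l by simp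
  show "0 < l" if "inj ((*v) B)"
  proof -
    have "B *v e \<noteq> 0" using that e(1) by (metis injD matrix_vector_mult_0_right norm_zero zero_neq_one)
    then show ?thesis by (simp add: l \<mu>_def)
  qed
qed

text \<open>On the range of \<open>B\<close> the transpose is bounded below by the same eigenvalue:
  for \<open>y = B *v x\<close>, Cauchy-Schwarz bounds the squared norm of \<open>y\<close> by the
  norms of \<open>transpose B *v y\<close> and \<open>x\<close>, and \<open>lambda_min_le\<close>
  bounds \<open>x\<close> by \<open>y\<close>. Outside the range the transpose may have a kernel,
  which is why multiplier increments must be kept inside it.\<close>

lemma lambda_min_le_norm_transpose:
  fixes B :: "real^'d^'m"
  assumes "y \<in> range ((*v) B)"
  shows "lambda_min (transpose B ** B) * (norm y)\<^sup>2 \<le> (norm (transpose B *v y))\<^sup>2"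
proof -
  let ?l = "lambda_min (transpose B ** B)"
  obtain x where y: "y = B *v x" using assms by blast
  have "(norm y)\<^sup>2 = (transpose B *v y) \<bullet> x"
    by (metis dot_lmul_matrix power2_norm_eq_inner transpose_matrix_vector y)
  also have "\<dots> \<le> norm (transpose B *v y) * norm x" by (rule norm_cauchy_schwarz)
  finally have "((norm y)\<^sup>2)\<^sup>2 \<le> (norm (transpose B *v y))\<^sup>2 * (norm x)\<^sup>2"
    by (metis power_mono power_mult_distrib zero_le_power2)
  show ?thesis
  proof (cases "?l \<le> 0 \<or> y = 0")
    case True
    then show ?thesis by (auto intro: order_trans[OF mult_nonpos_nonneg])
  next
    case False
    have "(?l * (norm y)\<^sup>2) * (norm y)\<^sup>2 = ?l * ((norm y)\<^sup>2)\<^sup>2" by (simp add: power2_eq_square)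
    also have "\<dots> \<le> ?l * ((norm (transpose B *v y))\<^sup>2 * (norm x)\<^sup>2)"
      using False \<open>((norm y)\<^sup>2)\<^sup>2 \<le> _\<close> by (intro mult_left_mono) auto
    also have "\<dots> = (norm (transpose B *v y))\<^sup>2 * (?l * (norm x)\<^sup>2)" by simp
    also have "\<dots> \<le> (norm (transpose B *v y))\<^sup>2 * (norm y)\<^sup>2"
      using lambda_min_le[of B x] by (intro mult_left_mono) (auto simp: y)
    finally show ?thesis using False by simp
  qed
qed

section \<open>Jacobians under Lipschitz assumptions\<close>

lemma norm_derivative_le_lipschitz:
  assumes der: "(f has_derivative f') (at x)" and lip: "L-lipschitz_on UNIV f"
  shows "norm (f' h) \<le> L * norm h"
proof -
  interpret f': bounded_linear f' using der by (rule has_derivative_bounded_linear)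
  have small: "norm (f' h) \<le> (L + e) * norm h" if e: "0 < e" and h: "h \<noteq> 0" for e
  proof -
    obtain d where d: "d > 0" "\<And>y. norm (y - x) < d \<Longrightarrow> norm (f y - f x - f' (y - x)) \<le> e * norm (y - x)"
      using der e unfolding has_derivative_at_alt by blast
    define t where "t = d / (2 * norm h)"
    have t: "0 < t" "t * norm h < d" using d(1) h by (auto simp: t_def)
    have "norm (f (x + t *\<^sub>R h) - f x - f' (t *\<^sub>R h)) \<le> e * (t * norm h)"
      using d(2)[of "x + t *\<^sub>R h"] t by simp
    moreover have "norm (f (x + t *\<^sub>R h) - f x) \<le> L * (t * norm h)"
      using lipschitz_onD[OF lip, of "x + t *\<^sub>R h" x] t(1) by (simp add: dist_norm)
    ultimately have "norm (f' (t *\<^sub>R h)) \<le> e * (t * norm h) + L * (t * norm h)"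
      using norm_triangle_sub[of "f' (t *\<^sub>R h)" "f (x + t *\<^sub>R h) - f x"]
      by (simp add: norm_minus_commute)
    then have "t * norm (f' h) \<le> t * ((L + e) * norm h)"
      using t(1) by (simp add: f'.scaleR algebra_simps)
    then show ?thesis using t(1) by simp
  qed
  show ?thesis
  proof (cases "h = 0")
    case False
    show ?thesis
    proof (rule field_le_epsilon)
      fix e :: real assume "0 < e"
      then show "norm (f' h) \<le> L * norm h + e"
        using small[of "e / norm h"] False by (simp add: distrib_right)
    qed
  qed (simp add: f'.zero)
qed

lemma jacobian_mult_component:
  fixes f :: "real^'n \<Rightarrow> real^'m"
  assumes "f differentiable at x"
  shows "(jacobian f (at x) *v h) $ j = h \<bullet> grad (\<lambda>x. f x $ j) x"
    and "GDERIV (\<lambda>x. f x $ j) x :> grad (\<lambda>x. f x $ j) x"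
proof -
  have "(f has_derivative (\<lambda>h. jacobian f (at x) *v h)) (at x)"
    using assms by (simp add: jacobian_works)
  then have d: "((\<lambda>x. f x $ j) has_derivative (\<lambda>h. (jacobian f (at x) *v h) $ j)) (at x)"
    by (rule bounded_linear.has_derivative[OF bounded_linear_vec_nth])
  then have "(\<lambda>x. f x $ j) differentiable at x" by (rule differentiableI)
  then show g: "GDERIV (\<lambda>x. f x $ j) x :> grad (\<lambda>x. f x $ j) x" by (rule GDERIV_grad)
  then have "(\<lambda>h. (jacobian f (at x) *v h) $ j) = (\<lambda>h. h \<bullet> grad (\<lambda>x. f x $ j) x)"
    unfolding gderiv_def by (rule has_derivative_unique[OF d])
  then show "(jacobian f (at x) *v h) $ j = h \<bullet> grad (\<lambda>x. f x $ j) x" by meson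
qed

lemma transpose_jacobian_mult:
  fixes f :: "real^'n \<Rightarrow> real^'m"
  assumes "f differentiable at x"
  shows "transpose (jacobian f (at x)) *v w = (\<Sum>j\<in>UNIV. (w $ j) *\<^sub>R grad (\<lambda>x. f x $ j) x)"
proof (rule vector_eq_rdot[THEN iffD1], rule allI)
  fix z
  have "z \<bullet> (transpose (jacobian f (at x)) *v w) = (jacobian f (at x) *v z) \<bullet> w"
    by (metis dot_lmul_matrix inner_commute transpose_matrix_vector)
  also have "\<dots> = z \<bullet> (\<Sum>j\<in>UNIV. (w $ j) *\<^sub>R grad (\<lambda>x. f x $ j) x)"
    by (simp add: inner_vec_def[of "jacobian f (at x) *v z"] jacobian_mult_component(1)[OF assms]
        inner_sum_right mult.commute)
  finally show "(transpose (jacobian f (at x)) *v w) \<bullet> z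
      = (\<Sum>j\<in>UNIV. (w $ j) *\<^sub>R grad (\<lambda>x. f x $ j) x) \<bullet> z" by (simp add: inner_commute)
qed

text \<open>Only the component gradients are assumed Lipschitz, so the scalar descent lemma is
  applied to each component and each weight is bounded by \<open>norm w\<close>. This is the origin
  of the sum of the component constants.\<close>

lemma componentwise_descent:
  fixes f :: "real^'n \<Rightarrow> real^'m"
  assumes diff: "\<And>x. f differentiable at x"
    and lip: "\<And>j. (L j)-lipschitz_on UNIV (grad (\<lambda>x. f x $ j))"
  shows "\<bar>w \<bullet> (f y - f x - jacobian f (at x) *v (y - x))\<bar>
    \<le> norm w * sum L UNIV / 2 * (norm (y - x))\<^sup>2"
proof -
  have "\<bar>w \<bullet> (f y - f x - jacobian f (at x) *v (y - x))\<bar>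
      = \<bar>\<Sum>j\<in>UNIV. w $ j * (f y $ j - f x $ j - grad (\<lambda>x. f x $ j) x \<bullet> (y - x))\<bar>"
    by (simp add: inner_vec_def[of w] jacobian_mult_component(1)[OF diff] inner_commute)
  also have "\<dots> \<le> (\<Sum>j\<in>UNIV. \<bar>w $ j\<bar> * \<bar>f y $ j - f x $ j - grad (\<lambda>x. f x $ j) x \<bullet> (y - x)\<bar>)"
    by (rule order_trans[OF sum_abs]) (simp add: abs_mult)
  also have "\<dots> \<le> (\<Sum>j\<in>UNIV. norm w * (L j / 2 * (norm (y - x))\<^sup>2))"
    by (intro sum_mono mult_mono component_le_norm_cart
        descent_lemma_abs[OF jacobian_mult_component(2)[OF diff] lip]) auto
  also have "\<dots> = norm w * sum L UNIV / 2 * (norm (y - x))\<^sup>2"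
    by (simp add: sum_distrib_left sum_distrib_right sum_divide_distrib mult.assoc)
  finally show ?thesis .
qed

lemma norm_transpose_jacobian_diff_le:
  fixes f :: "real^'n \<Rightarrow> real^'m"
  assumes diff: "\<And>x. f differentiable at x"
    and lip: "\<And>j. (L j)-lipschitz_on UNIV (grad (\<lambda>x. f x $ j))"
  shows "norm (transpose (jacobian f (at y)) *v w - transpose (jacobian f (at x)) *v w)
    \<le> norm w * sum L UNIV * norm (y - x)"
proof -
  have "norm (transpose (jacobian f (at y)) *v w - transpose (jacobian f (at x)) *v w)
      = norm (\<Sum>j\<in>UNIV. (w $ j) *\<^sub>R (grad (\<lambda>x. f x $ j) y - grad (\<lambda>x. f x $ j) x))"
    unfolding transpose_jacobian_mult[OF diff] by (simp add: sum_subtractf scaleR_diff_right)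
  also have "\<dots> \<le> (\<Sum>j\<in>UNIV. \<bar>w $ j\<bar> * norm (grad (\<lambda>x. f x $ j) y - grad (\<lambda>x. f x $ j) x))"
    by (rule order_trans[OF norm_sum]) simp
  also have "\<dots> \<le> (\<Sum>j\<in>UNIV. norm w * (L j * norm (y - x)))"
    using lipschitz_onD[OF lip]
    by (intro sum_mono mult_mono component_le_norm_cart) (auto simp: dist_norm)
  also have "\<dots> = norm w * sum L UNIV * norm (y - x)"
    by (simp add: sum_distrib_left sum_distrib_right mult.assoc)
  finally show ?thesis .
qed

lemma norm_transpose_jacobian_le:
  fixes f :: "real^'n \<Rightarrow> real^'m"
  assumes "f differentiable at x" and "L-lipschitz_on UNIV f"
  shows "norm (transpose (jacobian f (at x)) *v w) \<le> L * norm w"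
proof -
  have "(f has_derivative (\<lambda>h. jacobian f (at x) *v h)) (at x)"
    using assms(1) by (simp add: jacobian_works)
  then have "onorm ((*v) (jacobian f (at x))) \<le> L"
    by (intro onorm_le norm_derivative_le_lipschitz[OF _ assms(2)])
  then show ?thesis
    using norm_transpose_mult_le[of "jacobian f (at x)" w]
    by (meson mult_right_mono norm_ge_zero order_trans)
qed

lemma jacobian_add:
  fixes f g :: "real^'n \<Rightarrow> real^'m"
  assumes "f differentiable at x" "g differentiable at x"
  shows "jacobian (\<lambda>x. f x + g x) (at x) = jacobian f (at x) + jacobian g (at x)"
proof -
  have "((\<lambda>x. f x + g x) has_derivative (\<lambda>h. jacobian f (at x) *v h + jacobian g (at x) *v h)) (at x)"
    using assms by (intro has_derivative_add) (simp_all add: jacobian_works)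
  then have "frechet_derivative (\<lambda>x. f x + g x) (at x) = (*v) (jacobian f (at x) + jacobian g (at x))"
    by (simp add: frechet_derivative_at[symmetric] matrix_vector_mult_add_rdistrib fun_eq_iff)
  then show ?thesis by (simp add: jacobian_def)
qed

subsection \<open>Limiting subdifferentials and Fermat's rule\<close>

text \<open>Local minimality of \<open>f + g\<close> bounds the difference quotient of
  \<open>f\<close> below by minus the first-order remainder quotient of \<open>g\<close>, which
  tends to 0. Points where \<open>f\<close> is infinite only raise the quotient.\<close>

lemma frechet_subdiffI:
  fixes f :: "'a::euclidean_space \<Rightarrow> ereal"
  assumes fin: "\<bar>f x\<bar> \<noteq> \<infinity>" and der: "GDERIV g x :> D" and S: "open S" "x \<in> S"
    and min: "\<And>y. y \<in> S \<Longrightarrow> f x + ereal (g x) \<le> f y + ereal (g y)"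
  shows "- D \<in> frechet_subdiff f x"
proof -
  obtain a where a: "f x = ereal a" using fin by (cases "f x") auto
  define R where "R y = - ((g y - g x) - (y - x) \<bullet> D) / norm (y - x)" for y
  have "((\<lambda>y. ((g y - g x) - (y - x) \<bullet> D) /\<^sub>R norm (y - x)) \<longlongrightarrow> 0) (at x)"
    using der by (simp add: gderiv_def has_derivative_at_within)
  from tendsto_minus[OF this] have "(R \<longlongrightarrow> - 0) (at x)"
    by (simp add: R_def[abs_def] divide_inverse mult.commute flip: mult_minus_right)
  then have "((\<lambda>y. ereal (R y)) \<longlongrightarrow> 0) (at x)" by (simp add: zero_ereal_def)
  then have "0 = Liminf (at x) (\<lambda>y. ereal (R y))"
    by (intro lim_imp_Liminf[symmetric]) auto
  also have "\<dots> \<le> Liminf (at x) (\<lambda>y. (f y - f x - ereal (- D \<bullet> (y - x))) / ereal (norm (y - x)))"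
  proof (rule Liminf_mono)
    have "\<forall>\<^sub>F y in at x. y \<in> S" using S by (rule eventually_at_in_open')
    moreover have "\<forall>\<^sub>F y in at x. y \<noteq> x" by (simp add: eventually_at_filter)
    ultimately show "\<forall>\<^sub>F y in at x. ereal (R y)
        \<le> (f y - f x - ereal (- D \<bullet> (y - x))) / ereal (norm (y - x))"
    proof eventually_elim
      case (elim y)
      show ?case
      proof (cases "f y")
        case (real b)
        have "a + g x \<le> b + g y" using min[OF elim(1)] by (simp add: a real)
        then have "R y \<le> (b - a - (- D \<bullet> (y - x))) / norm (y - x)"
          unfolding R_def by (intro divide_right_mono) (auto simp: inner_commute)
        then show ?thesis using elim(2) by (simp add: real a)
      next
        case PInf
        then show ?thesis using elim(2) by (simp add: a divide_ereal_def)
      next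
        case MInf
        then show ?thesis using min[OF elim(1)] by (simp add: a)
      qed
    qed
  qed
  finally show ?thesis using fin by (simp add: frechet_subdiff_def)
qed

lemma frechet_subset_limiting: "frechet_subdiff f x \<subseteq> limiting_subdiff f x"
proof
  fix \<xi> assume "\<xi> \<in> frechet_subdiff f x"
  then have "\<bar>f x\<bar> \<noteq> \<infinity> \<and> (\<forall>k::nat. (\<lambda>_. \<xi>) k \<in> frechet_subdiff f ((\<lambda>_. x) k))"
    by (simp add: frechet_subdiff_def)
  then show "\<xi> \<in> limiting_subdiff f x"
    unfolding limiting_subdiff_def
    by (intro CollectI conjI exI[of _ "\<lambda>_. x"] exI[of _ "\<lambda>_. \<xi>"]) auto
qed

text \<open>
  The constraint and the base point are decoupled by minimising
  \<open>f x - \<xi> \<bullet> (x - a) + t * (norm (x - a))\<^sup>2 + N * (norm (x - y))\<^sup>2\<close> over \<open>x\<close> near \<open>a\<close> and \<open>y \<in> U\<close>.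
  With \<open>t = 2 * \<eta> / r\<close> the quadratic beats the error \<open>\<eta> * norm (x - a)\<close> near the boundary of the ball,
  yet its gradient is at most \<open>4 * \<eta>\<close>; a large \<open>N\<close> keeps both minimisers inside the ball.
\<close>

lemma fuzzy_constrained_fermat:
  fixes J :: "'a::euclidean_space \<Rightarrow> ereal"
  assumes U: "closed U" "convex U" "a \<in> U"
    and r: "0 < r" and \<eta>: "0 < \<eta>"
    and Jf: "\<And>x. x \<in> cball a r \<Longrightarrow> J x = ereal (f x)"
    and lip: "L-lipschitz_on (cball a r) f"
    and min: "\<And>x. x \<in> U \<inter> cball a r \<Longrightarrow> f a + \<xi> \<bullet> (x - a) - \<eta> * norm (x - a) \<le> f x"
  obtains x y \<zeta> \<nu> where "x \<in> ball a r" "y \<in> U \<inter> ball a r"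
    "\<zeta> \<in> frechet_subdiff J x" "\<nu> \<in> normal_cone U y"
    "norm (\<zeta> + \<nu> - \<xi>) \<le> 4 * \<eta>" "norm \<nu> \<le> 2 * (L + norm \<xi> + 4 * \<eta>)"
proof -
  define t where "t = 2 * \<eta> / r"
  define s where "s x = f x - \<xi> \<bullet> (x - a) + t * (norm (x - a))\<^sup>2" for x
  \<comment> \<open>\<open>C\<close> is a Lipschitz constant of \<open>s\<close> on the ball:
    \<open>L\<close> from \<open>f\<close>, \<open>norm \<xi>\<close> from the linear term and
    \<open>t * (2 * r) = 4 * \<eta>\<close> from the quadratic one. The two fractions in
    \<open>N\<close> will yield \<open>C * norm (x - y) < \<eta> * r / 4\<close> and
    \<open>norm (x - y) < r / 4\<close>.\<close>
  define C where "C = L + norm \<xi> + 4 * \<eta>"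
  define N where "N = 1 + 4 * C\<^sup>2 / (\<eta> * r) + 4 * C / r"
  have L0: "0 \<le> L" using lip by (rule lipschitz_on_nonneg)
  have t: "0 < t" "t * r = 2 * \<eta>" using r \<eta> by (auto simp: t_def)
  have C: "0 < C" using L0 \<eta> by (simp add: C_def add_nonneg_pos)
  have N: "0 < N" "4 * C\<^sup>2 < N * (\<eta> * r)" "4 * C < N * r"
  proof -
    show "0 < N" unfolding N_def using C r \<eta> by (intro add_pos_nonneg) auto
    have "4 * C\<^sup>2 = 4 * C\<^sup>2 / (\<eta> * r) * (\<eta> * r)" using r \<eta> by simp
    also have "\<dots> < N * (\<eta> * r)"
      unfolding N_def using C r \<eta> by (intro mult_strict_right_mono) (auto simp: add_pos_pos)
    finally show "4 * C\<^sup>2 < N * (\<eta> * r)" .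
    have "4 * C = 4 * C / r * r" using r by simp
    also have "\<dots> < N * r"
      unfolding N_def using C r \<eta> by (intro mult_strict_right_mono) (auto simp: add_pos_nonneg)
    finally show "4 * C < N * r" .
  qed
  have s_lip: "s y \<le> s x + C * norm (x - y)" if xy: "x \<in> cball a r" "y \<in> cball a r" for x y
  proof -
    have "f y - f x \<le> L * norm (x - y)"
      using lipschitz_onD[OF lip xy] by (simp add: dist_real_def dist_norm)
    moreover have "\<xi> \<bullet> (x - a) - \<xi> \<bullet> (y - a) \<le> norm \<xi> * norm (x - y)"
      using norm_cauchy_schwarz[of \<xi> "x - y"] by (simp add: inner_diff_right)
    moreover have "t * (norm (y - a))\<^sup>2 - t * (norm (x - a))\<^sup>2 \<le> 4 * \<eta> * norm (x - y)"
    proof -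
      have "norm (y - a) - norm (x - a) \<le> norm (x - y)"
        using norm_triangle_ineq2[of "y - a" "x - a"] by (simp add: norm_minus_commute)
      moreover have "norm (y - a) + norm (x - a) \<le> 2 * r"
        using xy by (simp add: dist_norm norm_minus_commute)
      ultimately have "(norm (y - a) - norm (x - a)) * (norm (y - a) + norm (x - a)) \<le> norm (x - y) * (2 * r)"
        by (intro order_trans[OF mult_right_mono mult_left_mono]) auto
      then have "t * ((norm (y - a))\<^sup>2 - (norm (x - a))\<^sup>2) \<le> t * (norm (x - y) * (2 * r))"
        using t(1) by (intro mult_left_mono) (auto simp: power2_eq_square algebra_simps)
      also have "\<dots> = 4 * \<eta> * norm (x - y)" using t(2) by (simp add: algebra_simps)
      finally show ?thesis by (simp add: algebra_simps)
    qed
    ultimately show ?thesis by (simp add: s_def C_def algebra_simps)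
  qed
  define h where "h = (\<lambda>(x, y). s x + N * (norm (x - y))\<^sup>2)"
  have aV: "a \<in> cball a r" "a \<in> U \<inter> cball a r" using U r by auto
  have "\<exists>z\<in>cball a r \<times> (U \<inter> cball a r). \<forall>w\<in>cball a r \<times> (U \<inter> cball a r). h z \<le> h w"
  proof (rule continuous_attains_inf)
    show "compact (cball a r \<times> (U \<inter> cball a r))"
      using U by (intro compact_Times closed_Int_compact) auto
    show "cball a r \<times> (U \<inter> cball a r) \<noteq> {}" using aV by blast
    have "continuous_on (cball a r \<times> (U \<inter> cball a r)) (\<lambda>z. f (fst z))"
      by (rule continuous_on_compose2[OF lipschitz_on_continuous_on[OF lip]])
         (auto intro: continuous_on_fst)
    then show "continuous_on (cball a r \<times> (U \<inter> cball a r)) h"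
      unfolding h_def s_def case_prod_unfold by (intro continuous_intros)
  qed
  then obtain x y where x: "x \<in> cball a r" and y: "y \<in> U \<inter> cball a r"
    and xy: "\<And>x' y'. x' \<in> cball a r \<Longrightarrow> y' \<in> U \<inter> cball a r \<Longrightarrow>
      s x + N * (norm (x - y))\<^sup>2 \<le> s x' + N * (norm (x' - y'))\<^sup>2"
    unfolding h_def by fastforce
  \<comment> \<open>The competitor \<open>(y, y)\<close> removes the penalty at the price of the
    variation of \<open>s\<close> between \<open>x\<close> and \<open>y\<close>.\<close>
  have gap: "N * norm (x - y) \<le> C"
  proof (cases "x = y")
    case False
    have "s x + N * (norm (x - y))\<^sup>2 \<le> s y" using xy[of y y] y by simp
    also have "\<dots> \<le> s x + C * norm (x - y)" using s_lip[of x y] x y by simp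
    finally have "(N * norm (x - y)) * norm (x - y) \<le> C * norm (x - y)"
      by (simp add: power2_eq_square algebra_simps)
    then show ?thesis using False by simp
  qed (use C in simp)
  have gap_r: "norm (x - y) < r / 4"
  proof -
    have "N * norm (x - y) < N * (r / 4)" using gap N(3) by simp
    then show ?thesis using N(1) by simp
  qed
  \<comment> \<open>Otherwise \<open>min\<close> and the quadratic term put \<open>s y\<close> at
    least \<open>3 / 8 * \<eta> * r\<close> above \<open>f a\<close>, while the competitor
    \<open>(a, a)\<close> together with \<open>gap\<close> puts it less than
    \<open>\<eta> * r / 4\<close> above.\<close>
  have y_in: "norm (y - a) < 3 * r / 4"
  proof (rule ccontr)
    assume "\<not> ?thesis"
    then have d: "3 * r / 4 \<le> norm (y - a)" by simp
    have "s y \<le> s x + C * norm (x - y)" using s_lip[of x y] x y by simp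
    also have "s x \<le> f a"
    proof -
      have "s x + N * (norm (x - y))\<^sup>2 \<le> s a" using xy[OF aV] by simp
      moreover have "s a = f a" by (simp add: s_def)
      moreover have "0 \<le> N * (norm (x - y))\<^sup>2" using N(1) by simp
      ultimately show ?thesis by linarith
    qed
    also have "C * norm (x - y) < \<eta> * r / 4"
    proof -
      have "N * (C * norm (x - y)) = C * (N * norm (x - y))" by simp
      also have "\<dots> \<le> C * C" using gap C by (intro mult_left_mono) auto
      also have "\<dots> < N * (\<eta> * r / 4)" using N(2) by (simp add: power2_eq_square)
      finally show ?thesis using N(1) by simp
    qed
    finally have "s y < f a + \<eta> * r / 4" by simp
    moreover have "f a - \<eta> * norm (y - a) + t * (norm (y - a))\<^sup>2 \<le> s y"
      using min[OF y] by (simp add: s_def)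
    ultimately have "norm (y - a) * (t * norm (y - a) - \<eta>) < \<eta> * r / 4"
      by (simp add: algebra_simps power2_eq_square)
    moreover have "(3 * r / 4) * (\<eta> / 2) \<le> norm (y - a) * (t * norm (y - a) - \<eta>)"
    proof (rule mult_mono[OF d])
      have "t * (3 * r / 4) \<le> t * norm (y - a)" using d t(1) by (intro mult_left_mono) auto
      then show "\<eta> / 2 \<le> t * norm (y - a) - \<eta>" using t(2) by simp
    qed (use \<eta> r in auto)
    moreover have "0 < \<eta> * r" using \<eta> r by simp
    ultimately show False by (simp add: field_simps)
  qed
  have x_in: "norm (x - a) < r"
    using norm_triangle_ineq[of "x - y" "y - a"] gap_r y_in by simp
  define \<nu> where "\<nu> = (2 * N) *\<^sub>R (x - y)"
  define \<zeta> where "\<zeta> = \<xi> - (2 * t) *\<^sub>R (x - a) - \<nu>"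
  have "- (- \<zeta>) \<in> frechet_subdiff J x"
  proof (rule frechet_subdiffI)
    let ?g = "\<lambda>z. - (\<xi> \<bullet> (z - a)) + t * (norm (z - a))\<^sup>2 + N * (norm (z - y))\<^sup>2"
    have "(?g has_derivative (\<lambda>h. - (\<xi> \<bullet> h) + t * ((x - a) \<bullet> h + h \<bullet> (x - a))
        + N * ((x - y) \<bullet> h + h \<bullet> (x - y)))) (at x)"
      unfolding power2_norm_eq_inner by (auto intro!: derivative_eq_intros)
    moreover have "(\<lambda>h. - (\<xi> \<bullet> h) + t * ((x - a) \<bullet> h + h \<bullet> (x - a))
        + N * ((x - y) \<bullet> h + h \<bullet> (x - y))) = (\<lambda>h. h \<bullet> - \<zeta>)"
      by (simp add: fun_eq_iff \<zeta>_def \<nu>_def inner_diff_left inner_diff_right inner_add_right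
          inner_commute algebra_simps)
    ultimately show "GDERIV ?g x :> - \<zeta>" by (simp add: gderiv_def)
    show "open (ball a r)" "x \<in> ball a r" using x_in by (auto simp: dist_norm norm_minus_commute)
    show "J x + ereal (?g x) \<le> J z + ereal (?g z)" if "z \<in> ball a r" for z
    proof -
      have z: "z \<in> cball a r" using that by simp
      show ?thesis using xy[OF z y] by (simp add: Jf[OF x] Jf[OF z] s_def)
    qed
    show "\<bar>J x\<bar> \<noteq> \<infinity>" by (simp add: Jf[OF x])
  qed
  moreover have "\<nu> \<in> normal_cone U y"
  proof -
    have "(x - y) \<bullet> (z - y) \<le> 0" if z: "z \<in> U" for z
    proof (cases "z = y")
      case False
      have cl: "\<forall>z\<in>U \<inter> cball a r. dist x y \<le> dist x z"
      proof
        fix z assume "z \<in> U \<inter> cball a r"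
        from xy[OF x this] N(1) show "dist x y \<le> dist x z" by (simp add: dist_norm)
      qed
      \<comment> \<open>Since \<open>y\<close> is within \<open>3 * r / 4\<close> of
        \<open>a\<close>, a move of length at most \<open>r / 4\<close> towards \<open>z\<close>
        stays in the ball. The projection inequality for \<open>U \<inter> cball a r\<close> thus
        extends to every \<open>z\<close> in \<open>U\<close>.\<close>
      define \<tau> where "\<tau> = min 1 (r / (4 * norm (z - y)))"
      have \<tau>: "0 < \<tau>" "\<tau> \<le> 1" using r False by (auto simp: \<tau>_def)
      have "\<tau> * norm (z - y) \<le> r / 4"
        using False mult_right_mono[of \<tau> "r / (4 * norm (z - y))" "norm (z - y)"] by (simp add: \<tau>_def)
      then have "norm (\<tau> *\<^sub>R (z - y)) \<le> r / 4" using \<tau>(1) by simp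
      then have "norm (y + \<tau> *\<^sub>R (z - y) - a) \<le> r"
        using norm_triangle_ineq[of "y - a" "\<tau> *\<^sub>R (z - y)"] y_in by (simp add: algebra_simps)
      moreover have "y + \<tau> *\<^sub>R (z - y) = (1 - \<tau>) *\<^sub>R y + \<tau> *\<^sub>R z" by (simp add: algebra_simps)
      then have "y + \<tau> *\<^sub>R (z - y) \<in> U"
        using U(2) y z \<tau> by (auto simp: convex_alt)
      ultimately have w: "y + \<tau> *\<^sub>R (z - y) \<in> U \<inter> cball a r"
        by (simp add: dist_norm norm_minus_commute)
      have "(x - y) \<bullet> (y + \<tau> *\<^sub>R (z - y) - y) \<le> 0"
        using U by (intro any_closest_point_dot[OF _ _ y w cl] convex_Int closed_Int) auto
      then show ?thesis using \<tau>(1) by (simp add: mult_le_0_iff)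
    qed simp
    then show ?thesis using N(1) by (auto simp: normal_cone_def \<nu>_def mult_le_0_iff)
  qed
  moreover have "norm (\<zeta> + \<nu> - \<xi>) \<le> 4 * \<eta>"
  proof -
    have "norm (\<zeta> + \<nu> - \<xi>) = 2 * t * norm (x - a)" using t(1) by (simp add: \<zeta>_def)
    also have "\<dots> \<le> 2 * t * r" using x_in t(1) by (intro mult_left_mono) auto
    finally show ?thesis using t(2) by simp
  qed
  moreover have "norm \<nu> \<le> 2 * (L + norm \<xi> + 4 * \<eta>)"
    using gap N(1) by (simp add: \<nu>_def C_def)
  moreover have "x \<in> ball a r" "y \<in> U \<inter> ball a r"
    using x_in y y_in r by (auto simp: dist_norm norm_minus_commute)
  ultimately show ?thesis using that by simp
qed

text \<open>The limit of the fuzzy rule as \<open>\<eta>\<close> tends to 0. The Lipschitz constant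
  of \<open>J\<close> keeps the normals bounded, so they converge along a subsequence, and the
  subgradients then converge as well because the sums tend to \<open>- D\<close>. Continuity of
  \<open>J\<close> near \<open>a\<close> supplies the convergence of values required by the limiting
  subdifferential, and normal inequalities survive moving base points.\<close>

lemma constrained_fermat:
  fixes J :: "'a::euclidean_space \<Rightarrow> ereal"
  assumes U: "closed U" "convex U" "a \<in> U"
    and lip: "locally_lipschitz_around J a"
    and der: "GDERIV g a :> D"
    and min: "\<And>x. x \<in> U \<Longrightarrow> J a + ereal (g a) \<le> J x + ereal (g x)"
  obtains \<zeta> \<nu> where "\<zeta> \<in> limiting_subdiff J a" "\<nu> \<in> normal_cone U a" "\<zeta> + \<nu> = - D"
proof -
  define f where "f = (\<lambda>x. real_of_ereal (J x))"
  obtain R L where R: "0 < R" and fin: "\<And>y. y \<in> ball a R \<Longrightarrow> \<bar>J y\<bar> \<noteq> \<infinity>"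
    and L: "L-lipschitz_on (ball a R) f"
    using lip unfolding locally_lipschitz_around_def f_def[symmetric] by (elim exE conjE) (rule that, simp_all)
  have Jf: "J x = ereal (f x)" if "x \<in> ball a R" for x
    using fin[OF that] by (simp add: f_def ereal_real)
  have step: "\<exists>x y \<zeta> \<nu>. dist a x < \<eta> \<and> x \<in> ball a R \<and> dist a y < \<eta> \<and> y \<in> U \<and>
      \<zeta> \<in> frechet_subdiff J x \<and> \<nu> \<in> normal_cone U y \<and>
      norm (\<zeta> + \<nu> - - D) \<le> 4 * \<eta> \<and> norm \<nu> \<le> 2 * (L + norm (- D) + 4 * \<eta>)"
    if \<eta>: "0 < \<eta>" for \<eta>
  proof -
    have "\<exists>d>0. \<forall>y. norm (y - a) < d \<longrightarrow> norm (g y - g a - (y - a) \<bullet> D) \<le> \<eta> * norm (y - a)"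
      using der \<eta> unfolding gderiv_def has_derivative_at_alt by blast
    then obtain d where d: "d > 0" "\<And>y. norm (y - a) < d \<Longrightarrow>
        \<bar>g y - g a - (y - a) \<bullet> D\<bar> \<le> \<eta> * norm (y - a)"
      by auto
    \<comment> \<open>\<open>r < d\<close> makes the linearization error of \<open>g\<close> an
      admissible error \<open>\<eta> * norm (x - a)\<close>, \<open>r < R\<close> keeps the ball
      where \<open>J\<close> is finite and Lipschitz, and \<open>r < \<eta>\<close> forces the base
      points to converge to \<open>a\<close>.\<close>
    define r where "r = min (d / 2) (min (R / 2) (\<eta> / 2))"
    have r: "0 < r" "r < d" "r < R" "r < \<eta>" using d(1) R \<eta> by (auto simp: r_def)
    have sub: "cball a r \<subseteq> ball a R" using r by auto
    obtain x y \<zeta> \<nu> where "x \<in> ball a r" "y \<in> U \<inter> ball a r"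
      "\<zeta> \<in> frechet_subdiff J x" "\<nu> \<in> normal_cone U y"
      "norm (\<zeta> + \<nu> - - D) \<le> 4 * \<eta>" "norm \<nu> \<le> 2 * (L + norm (- D) + 4 * \<eta>)"
    proof (rule fuzzy_constrained_fermat[OF U r(1) \<eta>, of J f L "- D"])
      show "J x = ereal (f x)" if "x \<in> cball a r" for x using Jf that sub by blast
      show "L-lipschitz_on (cball a r) f" using L sub by (rule lipschitz_on_subset)
      show "f a + - D \<bullet> (x - a) - \<eta> * norm (x - a) \<le> f x" if x: "x \<in> U \<inter> cball a r" for x
      proof -
        have "f a + g a \<le> f x + g x"
          using min[of x] Jf[of a] Jf[of x] x sub R by auto
        moreover have "\<bar>g x - g a - (x - a) \<bullet> D\<bar> \<le> \<eta> * norm (x - a)"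
          using x r(2) by (intro d(2)) (auto simp: dist_norm norm_minus_commute)
        ultimately show ?thesis by (simp add: inner_commute abs_le_iff)
      qed
    qed
    then show ?thesis using r sub by (intro exI[of _ x] exI[of _ y] exI[of _ \<zeta>] exI[of _ \<nu>]) auto
  qed
  have "\<forall>n. \<exists>x y \<zeta> \<nu>. dist a x < inverse (real (Suc n)) \<and> x \<in> ball a R \<and>
      dist a y < inverse (real (Suc n)) \<and> y \<in> U \<and>
      \<zeta> \<in> frechet_subdiff J x \<and> \<nu> \<in> normal_cone U y \<and>
      norm (\<zeta> + \<nu> - - D) \<le> 4 * inverse (real (Suc n)) \<and>
      norm \<nu> \<le> 2 * (L + norm (- D) + 4 * inverse (real (Suc n)))"
    using step by simp
  then obtain x y \<zeta> \<nu> where x: "\<And>n. dist a (x n) < inverse (real (Suc n))" "\<And>n. x n \<in> ball a R"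
    and y: "\<And>n. dist a (y n) < inverse (real (Suc n))" "\<And>n. y n \<in> U"
    and \<zeta>: "\<And>n. \<zeta> n \<in> frechet_subdiff J (x n)" and \<nu>: "\<And>n. \<nu> n \<in> normal_cone U (y n)"
    and sum: "\<And>n. norm (\<zeta> n + \<nu> n - - D) \<le> 4 * inverse (real (Suc n))"
    and bnd: "\<And>n. norm (\<nu> n) \<le> 2 * (L + norm (- D) + 4 * inverse (real (Suc n)))"
    unfolding choice_iff by blast
  have inv: "(\<lambda>n. inverse (real (Suc n))) \<longlonglongrightarrow> 0" by (rule LIMSEQ_inverse_real_of_nat)
  have "(\<lambda>n. dist (x n) a) \<longlonglongrightarrow> 0"
    by (rule Lim_null_comparison[OF _ inv]) (use x(1) in \<open>auto simp: dist_commute less_imp_le\<close>)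
  then have xlim: "x \<longlonglongrightarrow> a" by (rule tendsto_dist_iff[THEN iffD2])
  have "(\<lambda>n. dist (y n) a) \<longlonglongrightarrow> 0"
    by (rule Lim_null_comparison[OF _ inv]) (use y(1) in \<open>auto simp: dist_commute less_imp_le\<close>)
  then have ylim: "y \<longlonglongrightarrow> a" by (rule tendsto_dist_iff[THEN iffD2])
  have "(\<lambda>n. 4 * inverse (real (Suc n))) \<longlonglongrightarrow> 0" using inv by (rule tendsto_mult_right_zero)
  then have slim: "(\<lambda>n. \<zeta> n + \<nu> n - - D) \<longlonglongrightarrow> 0"
    by (rule Lim_null_comparison[rotated]) (use sum in auto)
  have "bounded (range \<nu>)"
  proof (rule boundedI)
    fix z assume "z \<in> range \<nu>"
    then obtain n where "z = \<nu> n" by blast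
    moreover have "inverse (real (Suc n)) \<le> 1" by (simp add: inverse_le_1_iff)
    ultimately show "norm z \<le> 2 * (L + norm (- D) + 4)" using bnd[of n] by simp
  qed
  then obtain \<nu>' \<sigma> where \<sigma>: "strict_mono (\<sigma> :: nat \<Rightarrow> nat)" and \<nu>lim: "(\<nu> \<circ> \<sigma>) \<longlonglongrightarrow> \<nu>'"
    using bounded_imp_convergent_subsequence by blast
  define \<zeta>' where "\<zeta>' = - D - \<nu>'"
  have "((\<lambda>n. \<zeta> n + \<nu> n - - D) \<circ> \<sigma>) \<longlonglongrightarrow> 0" using slim \<sigma> by (rule LIMSEQ_subseq_LIMSEQ)
  from tendsto_diff[OF tendsto_add[OF this tendsto_const[of "- D"]] \<nu>lim]
  have \<zeta>lim: "(\<zeta> \<circ> \<sigma>) \<longlonglongrightarrow> \<zeta>'" by (simp add: \<zeta>'_def o_def)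
  have xslim: "(x \<circ> \<sigma>) \<longlonglongrightarrow> a" using xlim \<sigma> by (rule LIMSEQ_subseq_LIMSEQ)
  have "\<nu>' \<in> normal_cone U a"
  proof -
    have "\<nu>' \<bullet> (z - a) \<le> 0" if "z \<in> U" for z
    proof (rule LIMSEQ_le_const2)
      show "(\<lambda>n. (\<nu> \<circ> \<sigma>) n \<bullet> (z - (y \<circ> \<sigma>) n)) \<longlonglongrightarrow> \<nu>' \<bullet> (z - a)"
        by (intro tendsto_intros \<nu>lim LIMSEQ_subseq_LIMSEQ[OF ylim \<sigma>])
      show "\<exists>N. \<forall>n\<ge>N. (\<nu> \<circ> \<sigma>) n \<bullet> (z - (y \<circ> \<sigma>) n) \<le> 0"
        using \<nu> that by (auto simp: normal_cone_def)
    qed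
    then show ?thesis by (simp add: normal_cone_def)
  qed
  moreover have "\<zeta>' \<in> limiting_subdiff J a"
  proof -
    have aR: "a \<in> ball a R" using R by simp
    have "continuous_on (ball a R) f" using L by (rule lipschitz_on_continuous_on)
    then have "isCont f a" using aR continuous_on_eq_continuous_at open_ball by blast
    then have "(\<lambda>n. f ((x \<circ> \<sigma>) n)) \<longlonglongrightarrow> f a" using xslim by (rule isCont_tendsto_compose)
    then have "(\<lambda>n. J ((x \<circ> \<sigma>) n)) \<longlonglongrightarrow> J a" using Jf[OF aR] Jf[OF x(2)] by simp
    moreover have "\<forall>k. (\<zeta> \<circ> \<sigma>) k \<in> frechet_subdiff J ((x \<circ> \<sigma>) k)" using \<zeta> by simp
    ultimately show ?thesis
      unfolding limiting_subdiff_def using fin[OF aR] xslim \<zeta>lim by blast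
  qed
  moreover have "\<zeta>' + \<nu>' = - D" by (simp add: \<zeta>'_def)
  ultimately show ?thesis using that by blast
qed

subsection \<open>Sequences\<close>

text \<open>The upper half of \<open>{1..k}\<close> has at least \<open>k / 2\<close> indices, and
  at each of them the squared minimum is at most \<open>b j\<close>. Hence \<open>k / 2\<close>
  times the squared minimum is at most a tail of a convergent series; the tail, rather than the
  whole sum, gives little-o instead of big-O.\<close>

lemma running_Min_smallo_inverse_sqrt:
  fixes S :: "nat \<Rightarrow> ereal" and b :: "nat \<Rightarrow> real"
  assumes S0: "\<And>j. 0 \<le> S j" and b0: "\<And>j. 0 \<le> b j" and sum: "summable b"
    and le: "\<And>j. start \<le> j \<Longrightarrow> S j \<le> ereal (sqrt (b j))"
  shows "(\<forall>\<^sub>F k in sequentially. (MIN j\<in>{1..k}. S j) < \<infinity>) \<and>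
    (\<lambda>k. real_of_ereal (MIN j\<in>{1..k}. S j)) \<in> o(\<lambda>k. 1 / sqrt (real k))"
proof
  define m where "m k = (MIN j\<in>{1..k}. S j)" for k
  have m_le: "m k \<le> S j" if "j \<in> {1..k}" for j k
    unfolding m_def using that by (intro Min_le) auto
  have m_ge: "0 \<le> m k" if "1 \<le> k" for k
    unfolding m_def using that S0 by (subst Min_ge_iff) auto
  have m_fin: "m k \<le> ereal (sqrt (b j))" if "start \<le> j" "j \<in> {1..k}" for j k
    using m_le[OF that(2)] le[OF that(1)] by (rule order_trans)
  have "\<forall>\<^sub>F k in sequentially. m k < \<infinity>"
  proof (rule eventually_sequentiallyI)
    fix k assume "max start 1 \<le> k"
    then have "m k \<le> ereal (sqrt (b k))" by (intro m_fin) auto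
    then show "m k < \<infinity>" by auto
  qed
  then show "\<forall>\<^sub>F k in sequentially. (MIN j\<in>{1..k}. S j) < \<infinity>" by (simp add: m_def)
  have "(\<lambda>k. real_of_ereal (m k)) \<in> o(\<lambda>k. 1 / sqrt (real k))"
  proof (rule landau_o.smallI)
    fix c :: real assume c: "0 < c"
    then have "0 < c\<^sup>2 / 2" by simp
    then obtain N where N: "\<And>i n. i \<ge> N \<Longrightarrow> norm (sum b {i..<n}) < c\<^sup>2 / 2"
      using sum unfolding summable_Cauchy by blast
    show "\<forall>\<^sub>F k in sequentially. norm (real_of_ereal (m k)) \<le> c * norm (1 / sqrt (real k))"
    proof (rule eventually_sequentiallyI)
      fix k assume k: "2 * (N + start + 1) \<le> k"
      define r where "r = real_of_ereal (m k)"
      let ?A = "{k div 2 + 1..<Suc k}"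
      have mk: "m k \<le> ereal (sqrt (b j))" if "j \<in> ?A" for j
        using that k by (intro m_fin) auto
      have "0 \<le> m k" using k by (intro m_ge) simp
      moreover have "m k \<le> ereal (sqrt (b k))" using k by (intro mk) auto
      ultimately have r: "m k = ereal r" "0 \<le> r"
        unfolding r_def by (cases "m k"; auto)+
      have rb: "r\<^sup>2 \<le> b j" if "j \<in> ?A" for j
        using mk[OF that] r b0[of j] by (simp add: real_le_rsqrt sqrt_ge_absD)
      have "real k / 2 \<le> real (card ?A)" by simp
      then have "real k / 2 * r\<^sup>2 \<le> real (card ?A) * r\<^sup>2" by (intro mult_right_mono) auto
      also have "\<dots> = (\<Sum>j\<in>?A. r\<^sup>2)" by simp
      also have "\<dots> \<le> sum b ?A" using rb by (rule sum_mono)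
      also have "\<dots> \<le> c\<^sup>2 / 2"
      proof -
        have "norm (sum b ?A) < c\<^sup>2 / 2" using k by (intro N) auto
        then show ?thesis unfolding real_norm_def by linarith
      qed
      finally have "real k * r\<^sup>2 \<le> c\<^sup>2" by simp
      then have "(r * sqrt (real k))\<^sup>2 \<le> c\<^sup>2" by (simp add: power_mult_distrib mult.commute)
      then have "r * sqrt (real k) \<le> c" by (rule power2_le_imp_le) (use c in simp)
      then show "norm (real_of_ereal (m k)) \<le> c * norm (1 / sqrt (real k))"
        using k r(2) by (simp add: r_def[symmetric] field_simps)
    qed
  qed
  then show "(\<lambda>k. real_of_ereal (MIN j\<in>{1..k}. S j)) \<in> o(\<lambda>k. 1 / sqrt (real k))"
    by (simp add: m_def)
qed

lemma summable_if_telescoping_bound: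
  fixes b \<Lambda> :: "nat \<Rightarrow> real"
  assumes b0: "\<And>k. 0 \<le> b k" and low: "\<And>k. c \<le> \<Lambda> k"
    and step: "\<And>k. \<Lambda> (Suc k) + b k \<le> \<Lambda> k"
  shows "summable b"
proof (rule bounded_imp_summable[where B = "\<Lambda> 0 - c"])
  fix n
  have "\<Lambda> (Suc n) + sum b {..n} \<le> \<Lambda> 0" for n
    by (induction n) (use step in \<open>auto intro: order_trans simp: algebra_simps\<close>, smt (verit) step)
  then show "sum b {..n} \<le> \<Lambda> 0 - c" using low[of "Suc n"] by (smt (verit))
qed (fact b0)

lemma Bseq_lipschitz_comp:
  fixes f :: "'a::real_normed_vector \<Rightarrow> 'b::real_normed_vector"
  assumes lip: "L-lipschitz_on UNIV f" and x: "Bseq x"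
  shows "Bseq (\<lambda>k. f (x k))"
proof -
  obtain R where R: "\<And>k. norm (x k) \<le> R" using x unfolding Bseq_def by blast
  show ?thesis
  proof (rule BseqI')
    fix k
    have "norm (f (x k) - f 0) \<le> L * norm (x k)"
      using lipschitz_onD[OF lip, of "x k" 0] by (simp add: dist_norm)
    also have "\<dots> \<le> L * R" using R lipschitz_on_nonneg[OF lip] by (intro mult_left_mono) auto
    finally show "norm (f (x k)) \<le> norm (f 0) + L * R"
      using norm_triangle_sub[of "f (x k)" "f 0"] by linarith
  qed
qed

lemma Bseq_Pair:
  fixes x :: "nat \<Rightarrow> 'a::real_normed_vector" and y :: "nat \<Rightarrow> 'b::real_normed_vector"
  assumes "Bseq x" "Bseq y"
  shows "Bseq (\<lambda>k. (x k, y k))"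
proof -
  obtain R S where "\<And>k. norm (x k) \<le> R" "\<And>k. norm (y k) \<le> S"
    using assms unfolding Bseq_def by metis
  then show ?thesis
    by (intro BseqI'[of _ "R + S"]) (meson add_mono norm_Pair_le order_trans)
qed

lemma summable_imp_bounded_terms:
  fixes f :: "nat \<Rightarrow> real"
  assumes "summable f"
  obtains D where "\<And>k. f k \<le> D"
proof -
  have "Bseq f" using summable_LIMSEQ_zero[OF assms] convergentI convergent_imp_Bseq by blast
  then obtain D where "\<And>k. norm (f k) \<le> D" unfolding Bseq_def by blast
  then show ?thesis using that by (metis abs_le_D1 real_norm_def)
qed

text \<open>Inserts the stationarity expression of the previous \<open>v\<close>-step: in the
  application the last bracket is the left side of \<open>v_opt\<close>, with \<open>w\<close> its
  proximal term, and vanishes.\<close>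

lemma telescope_sum3: "a' + b' + c' = (a' - a) + (b' - b) + (c' - c) - w + (a + b + c + w)"
  for a b c a' b' c' w :: "'a::ab_group_add"
  by (simp add: algebra_simps)

lemma two_sum_power2_le: "(a + b)\<^sup>2 \<le> 2 * (a\<^sup>2 + b\<^sup>2)" for a b :: real
proof -
  have "0 \<le> (a - b)\<^sup>2" by simp
  then show ?thesis by (simp add: power2_eq_square algebra_simps)
qed

lemma four_sum_power2_le: "(a + b + c + d)\<^sup>2 \<le> 4 * (a\<^sup>2 + b\<^sup>2 + c\<^sup>2 + d\<^sup>2)" for a b c d :: real
proof -
  have "0 \<le> (a - b)\<^sup>2 + (a - c)\<^sup>2 + (a - d)\<^sup>2 + (b - c)\<^sup>2 + (b - d)\<^sup>2 + (c - d)\<^sup>2" by simp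
  then show ?thesis by (simp add: power2_eq_square algebra_simps)
qed

lemma transpose_add_mult: "transpose (A + C) *v x = transpose A *v x + transpose C *v x"
  for A C :: "real^'n^'m"
  by (simp add: vec_eq_iff matrix_vector_mult_def transpose_def distrib_right sum.distrib)

subsection \<open>Runs of NAPP-AL\<close>

lemma transpose_mult_inner: "(transpose A *v y) \<bullet> x = y \<bullet> (A *v x)"
  for A :: "real^'n^'m"
  by (simp add: transpose_matrix_vector dot_lmul_matrix)

lemma three_sum_power2_le: "(a + b + c)\<^sup>2 \<le> 3 * (a\<^sup>2 + b\<^sup>2 + c\<^sup>2)" for a b c :: real
proof -
  have "0 \<le> (a - b)\<^sup>2 + (b - c)\<^sup>2 + (a - c)\<^sup>2" by simp
  then show ?thesis by (simp add: power2_eq_square algebra_simps)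
qed

lemma power2_div_le:
  fixes x c :: real
  assumes "0 \<le> x" "0 < c" "4 * x \<le> c"
  shows "x\<^sup>2 / c \<le> c / 16"
proof -
  have "(4 * x)\<^sup>2 \<le> c\<^sup>2" using assms by (intro power_mono) auto
  then show ?thesis using assms(2) by (simp add: power_mult_distrib divide_le_eq power2_eq_square)
qed

locale napp_run =
  fixes G :: "(real^'n) \<times> (real^'d) \<Rightarrow> real"
    and J :: "real^'n \<Rightarrow> ereal"
    and H :: "real^'d \<Rightarrow> real"
    and \<Theta> \<Omega> \<Phi> :: "real^'n \<Rightarrow> real^'m"
    and B :: "real^'d^'m"
    and U :: "(real^'n) set"
    and K :: "real^'n \<Rightarrow> real"
    and L_G L_H L_Theta L_Omega L_K \<beta> \<gamma> \<sigma> :: real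
    and L_Omega_comp :: "'m \<Rightarrow> real"
    and \<delta> \<epsilon> :: "nat \<Rightarrow> real"
    and u :: "nat \<Rightarrow> real^'n" and v :: "nat \<Rightarrow> real^'d" and p q :: "nat \<Rightarrow> real^'m"
  assumes U: "closed U" "convex U"
    and Theta: "\<Theta> = (\<lambda>x. \<Omega> x + \<Phi> x)"
    and Omega_diff: "\<And>x. \<Omega> differentiable at x"
    and Phi_diff: "\<And>x. \<Phi> differentiable at x"
    and G_diff: "\<And>w. G differentiable at w" and G_lip: "L_G-lipschitz_on UNIV (grad G)"
    and H_diff: "\<And>y. H differentiable at y" and H_lip: "L_H-lipschitz_on UNIV (grad H)"
    and J_proper: "proper J"
    and J_lip: "\<And>x. U \<noteq> UNIV \<Longrightarrow> x \<in> eff_dom J \<inter> U \<Longrightarrow> locally_lipschitz_around J x"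
    and Theta_lip: "L_Theta-lipschitz_on UNIV \<Theta>"
    and Omega_lip: "\<And>j. (L_Omega_comp j)-lipschitz_on UNIV (grad (\<lambda>x. \<Omega> x $ j))"
    and L_Omega: "L_Omega = (\<Sum>j\<in>UNIV. L_Omega_comp j)"
    and B_inj: "inj ((*v) B)" and range_Theta: "range \<Theta> \<subseteq> range ((*v) B)"
    and bounded_below: "\<exists>c::real. \<forall>z \<in> {(x, y). \<Theta> x + B *v y = 0}. ereal c \<le> objective G J H z"
    and coercive: "coercive_on {(x, y). \<Theta> x + B *v y = 0} (objective G J H)"
    and K_diff: "\<And>x. K differentiable at x" and beta: "\<beta> > 0" and K_sc: "strongly_convex \<beta> K"
    and K_lip: "L_K-lipschitz_on UNIV (grad K)"
    and gamma: "\<gamma> > 0"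
      "\<gamma> > (sqrt 57 + 1) / (2 * lambda_min (transpose B ** B)) * (L_G + L_H)"
    and sigma: "0 < \<sigma>"
    and alg: "napp_al G J H \<Omega> \<Phi> B U K \<gamma> \<sigma> \<delta> \<epsilon> q u v p"
    and delta: "\<And>k. \<delta> k = \<beta> * inverse
      (L_G + norm (q k) * L_Omega + \<gamma> * L_Theta\<^sup>2
       + 14 * \<gamma> * (onorm ((*v) B))\<^sup>2 * L_Theta\<^sup>2 / lambda_min (transpose B ** B)
       + 14 * (L_G + \<gamma> * onorm ((*v) B) * L_Theta)\<^sup>2 / (\<gamma> * lambda_min (transpose B ** B))
       + 1)"
begin

abbreviation "lam \<equiv> lambda_min (transpose B ** B)"
abbreviation "nB \<equiv> onorm ((*v) B)"
abbreviation "L_GH \<equiv> L_G + L_H"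
text \<open>\<open>N\<close> is a Lipschitz constant of
  \<open>\<gamma> *\<^sub>R (transpose B *v \<Theta> x)\<close> in \<open>x\<close>;
  \<open>M\<close> adds the contribution of the gradient of \<open>G\<close>.\<close>

abbreviation "N \<equiv> \<gamma> * nB * L_Theta"
abbreviation "M \<equiv> L_G + \<gamma> * nB * L_Theta"
abbreviation "du k \<equiv> norm (u (Suc k) - u k)"
abbreviation "dv k \<equiv> norm (v (Suc k) - v k)"
abbreviation "dp k \<equiv> norm (p (Suc k) - p k)"
abbreviation "r k \<equiv> \<Theta> (u k) + B *v v k"
abbreviation "gu k \<equiv> fst (grad G (u k, v k))"
abbreviation "gv k \<equiv> snd (grad G (u k, v k))"
abbreviation "gh k \<equiv> grad H (v k)"
text \<open>\<open>real_of_ereal\<close> sends infinite values to 0, so \<open>j 0\<close> need not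
  represent \<open>J (u 0)\<close>. From index 1 on, \<open>J_finite\<close> makes \<open>j\<close>
  the true value.\<close>

abbreviation "j k \<equiv> real_of_ereal (J (u k))"
abbreviation "u_smooth k x \<equiv> gu k \<bullet> x + q k \<bullet> (jacobian \<Omega> (at (u k)) *v x + \<Phi> x)
  + 1 / \<epsilon> k * bregman K x (u k)"

lemma lam_pos: "0 < lam" using B_inj by (rule lambda_min_pos)

lemma constants_nonneg: "0 \<le> L_G" "0 \<le> L_H" "0 \<le> L_Theta" "0 \<le> L_Omega" "0 \<le> L_K" "0 \<le> nB"
  unfolding L_Omega
  using lipschitz_on_nonneg[OF G_lip] lipschitz_on_nonneg[OF H_lip] lipschitz_on_nonneg[OF Theta_lip]
    lipschitz_on_nonneg[OF K_lip] sum_nonneg[OF lipschitz_on_nonneg[OF Omega_lip]]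
  by (simp_all add: onorm_pos_le)

lemma lam_le: "lam \<le> nB\<^sup>2"
proof -
  obtain x :: "real^'d" where x: "norm x = 1" using vector_choose_size[of 1] by auto
  have "lam \<le> (norm (B *v x))\<^sup>2" using lambda_min_le[of B x] x by simp
  also have "\<dots> \<le> (nB * norm x)\<^sup>2" by (intro power_mono onorm) auto
  finally show ?thesis using x by simp
qed

text \<open>The constant \<open>sqrt 57\<close> of the step size condition enters only through this bound.\<close>

lemma gamma_lam: "4 * L_GH \<le> \<gamma> * lam"
proof -
  have "7 \<le> sqrt 57" by (rule real_le_rsqrt) simp
  then have "8 * L_GH \<le> (sqrt 57 + 1) * L_GH"
    using constants_nonneg by (intro mult_right_mono) auto
  also have "\<dots> < 2 * (\<gamma> * lam)" using gamma(2) lam_pos by (simp add: field_simps)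
  finally show ?thesis by simp
qed

lemma gl_pos: "0 < \<gamma> * lam" using gamma lam_pos by simp

section \<open>Optimality of the individual steps\<close>

lemma q_eq: "q k = p k + \<gamma> *\<^sub>R r k"
  and eps: "0 < \<delta> k" "\<sigma> * \<delta> k \<le> \<epsilon> k" "\<epsilon> k \<le> \<delta> k"
  and p_eq: "p (Suc k) = p k + \<gamma> *\<^sub>R r (Suc k)"
  using alg[unfolded napp_al_def Let_def, rule_format, of k] unfolding Theta by blast+

lemma eps_pos: "0 < \<epsilon> k"
  using eps[of k] sigma by (meson mult_pos_pos order_less_le_trans)

lemma grad_G_fst: "grad (\<lambda>u'. G (u', y)) x = fst (grad G (x, y))"
  by (rule grad_eqI[OF GDERIV_partial_fst[OF G_diff]])

lemma grad_G_snd: "grad (\<lambda>v'. G (x, v')) y = snd (grad G (x, y))"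
  by (rule grad_eqI[OF GDERIV_partial_snd[OF G_diff]])

lemma u_in_U: "u (Suc k) \<in> U"
  and J_finite: "\<bar>J (u (Suc k))\<bar> \<noteq> \<infinity>"
  and u_min: "x \<in> U \<Longrightarrow> J (u (Suc k)) + ereal (u_smooth k (u (Suc k))) \<le> J x + ereal (u_smooth k x)"
proof -
  define ob where "ob x = ereal (gu k \<bullet> x) + J x + ereal (q k \<bullet> (jacobian \<Omega> (at (u k)) *v x + \<Phi> x)
                            + 1 / \<epsilon> k * bregman K x (u k))" for x
  have am: "is_arg_min ob (\<lambda>x. x \<in> U) (u (Suc k))" "ob (u (Suc k)) < \<infinity>"
    using alg[unfolded napp_al_def Let_def, rule_format, of k] unfolding ob_def[abs_def] grad_G_fst by auto
  have ob: "ob x = J x + ereal (u_smooth k x)" for x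
    by (cases "J x") (auto simp: ob_def)
  show "u (Suc k) \<in> U" using am(1) by (simp add: is_arg_min_def)
  have "J (u (Suc k)) \<noteq> -\<infinity>" using J_proper by (simp add: proper_def)
  then show "\<bar>J (u (Suc k))\<bar> \<noteq> \<infinity>" using am(2) by (cases "J (u (Suc k))") (auto simp: ob)
  show "J (u (Suc k)) + ereal (u_smooth k (u (Suc k))) \<le> J x + ereal (u_smooth k x)" if "x \<in> U"
    using am(1) that unfolding is_arg_min_def ob by (auto simp: not_less)
qed

lemma v_opt: "gv k + gh k + transpose B *v q k
    + \<gamma> *\<^sub>R (transpose B *v (B *v (v (Suc k) - v k))) = 0"
proof (rule GDERIV_eq_zero_if_minimum[OF _ open_UNIV])
  let ?f = "\<lambda>y. (gv k + gh k) \<bullet> y + q k \<bullet> (B *v y) + \<gamma> / 2 * (norm (B *v (y - v k)))\<^sup>2"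
  have "is_arg_min ?f (\<lambda>y. True) (v (Suc k))"
    using alg[unfolded napp_al_def Let_def, rule_format, of k] unfolding grad_G_snd by blast
  then show "?f (v (Suc k)) \<le> ?f y" for y by (simp add: is_arg_min_def not_less)
  have d: "((\<lambda>y. B *v y) has_derivative (\<lambda>h. B *v h)) (at y)" for y
    by (rule bounded_linear.has_derivative[OF matrix_vector_mul_bounded_linear]) auto
  have d2: "((\<lambda>y. B *v (y - v k)) has_derivative (\<lambda>h. B *v h)) (at y)" for y
    by (rule bounded_linear.has_derivative[OF matrix_vector_mul_bounded_linear])
       (auto intro!: derivative_eq_intros)
  have "(?f has_derivative (\<lambda>h. (gv k + gh k) \<bullet> h + q k \<bullet> (B *v h)
      + \<gamma> / 2 * ((B *v (v (Suc k) - v k)) \<bullet> (B *v h) + (B *v h) \<bullet> (B *v (v (Suc k) - v k))))) (at (v (Suc k)))"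
    unfolding power2_norm_eq_inner by (auto intro!: derivative_eq_intros d d2)
  moreover have "(\<lambda>h. (gv k + gh k) \<bullet> h + q k \<bullet> (B *v h)
      + \<gamma> / 2 * ((B *v (v (Suc k) - v k)) \<bullet> (B *v h) + (B *v h) \<bullet> (B *v (v (Suc k) - v k))))
    = (\<lambda>h. h \<bullet> (gv k + gh k + transpose B *v q k
        + \<gamma> *\<^sub>R (transpose B *v (B *v (v (Suc k) - v k)))))"
  proof
    fix h
    have "h \<bullet> (gv k + gh k + transpose B *v q k + \<gamma> *\<^sub>R (transpose B *v (B *v (v (Suc k) - v k))))
      = (gv k + gh k) \<bullet> h + (transpose B *v q k) \<bullet> h
        + \<gamma> * ((transpose B *v (B *v (v (Suc k) - v k))) \<bullet> h)"
      by (simp add: inner_add_right inner_add_left inner_commute)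
    then show "(gv k + gh k) \<bullet> h + q k \<bullet> (B *v h)
      + \<gamma> / 2 * ((B *v (v (Suc k) - v k)) \<bullet> (B *v h) + (B *v h) \<bullet> (B *v (v (Suc k) - v k)))
      = h \<bullet> (gv k + gh k + transpose B *v q k + \<gamma> *\<^sub>R (transpose B *v (B *v (v (Suc k) - v k))))"
      unfolding transpose_mult_inner by (simp add: inner_commute)
  qed
  ultimately show "GDERIV ?f (v (Suc k)) :> gv k + gh k + transpose B *v q k
    + \<gamma> *\<^sub>R (transpose B *v (B *v (v (Suc k) - v k)))" by (simp add: gderiv_def)
qed simp

text \<open>\<open>q k\<close> already contains a multiplier step with the old residual. Adding the
  proximal term of the \<open>v\<close>-step updates the part \<open>B *v v k\<close> of that
  residual, so only the change of \<open>\<Theta>\<close> separates the result from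
  \<open>p (Suc k)\<close>.\<close>

lemma dual: "transpose B *v p (Suc k) =
    - (gv k + gh k) + \<gamma> *\<^sub>R (transpose B *v (\<Theta> (u (Suc k)) - \<Theta> (u k)))"
proof -
  have "p (Suc k) = q k + \<gamma> *\<^sub>R (B *v (v (Suc k) - v k)) + \<gamma> *\<^sub>R (\<Theta> (u (Suc k)) - \<Theta> (u k))"
    unfolding q_eq p_eq[of k] by (simp add: algebra_simps matrix_vector_mult_diff_distrib)
  then have "transpose B *v p (Suc k) = transpose B *v q k
      + \<gamma> *\<^sub>R (transpose B *v (B *v (v (Suc k) - v k)))
      + \<gamma> *\<^sub>R (transpose B *v (\<Theta> (u (Suc k)) - \<Theta> (u k)))"
    by (simp add: matrix_vector_right_distrib matrix_vector_mult_scaleR[symmetric])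
  moreover have "transpose B *v q k + \<gamma> *\<^sub>R (transpose B *v (B *v (v (Suc k) - v k)))
      = - (gv k + gh k)"
    using v_opt[of k] by (simp only: add.assoc eq_neg_iff_add_eq_0 add.commute add.left_commute)
  ultimately show ?thesis by simp
qed

section \<open>Bounds on increments of gradients and multipliers\<close>

lemma norm_dTheta: "norm (\<Theta> (u (Suc k)) - \<Theta> (u k)) \<le> L_Theta * du k"
  using lipschitz_onD[OF Theta_lip, of "u (Suc k)" "u k"] by (simp add: dist_norm)

lemma norm_dG: "norm (grad G (u (Suc k), v (Suc k)) - grad G (u k, v k)) \<le> L_G * (du k + dv k)"
proof -
  have "norm (grad G (u (Suc k), v (Suc k)) - grad G (u k, v k))
      \<le> L_G * norm (u (Suc k) - u k, v (Suc k) - v k)"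
    using lipschitz_onD[OF G_lip, of "(u (Suc k), v (Suc k))" "(u k, v k)"] by (simp add: dist_norm)
  also have "\<dots> \<le> L_G * (du k + dv k)"
    using constants_nonneg by (intro mult_left_mono norm_Pair_le) auto
  finally show ?thesis .
qed

lemma norm_dgu: "norm (gu (Suc k) - gu k) \<le> L_G * (du k + dv k)"
  and norm_dgv: "norm (gv (Suc k) - gv k) \<le> L_G * (du k + dv k)"
proof -
  let ?d = "grad G (u (Suc k), v (Suc k)) - grad G (u k, v k)"
  have "norm (fst ?d) \<le> norm ?d" "norm (snd ?d) \<le> norm ?d"
    using norm_fst_le[of "fst ?d" "snd ?d"] norm_snd_le[of "snd ?d" "fst ?d"]
    by (simp_all only: prod.collapse)
  with norm_dG[of k] show "norm (gu (Suc k) - gu k) \<le> L_G * (du k + dv k)"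
    "norm (gv (Suc k) - gv k) \<le> L_G * (du k + dv k)" by simp_all
qed

lemma norm_dgh: "norm (gh (Suc k) - gh k) \<le> L_H * dv k"
  using lipschitz_onD[OF H_lip, of "v (Suc k)" "v k"] by (simp add: dist_norm)

lemma norm_Bt_dTheta: "norm (\<gamma> *\<^sub>R (transpose B *v (\<Theta> (u (Suc k)) - \<Theta> (u k)))) \<le> N * du k"
proof -
  have "norm (transpose B *v (\<Theta> (u (Suc k)) - \<Theta> (u k))) \<le> nB * (L_Theta * du k)"
    using constants_nonneg norm_dTheta[of k]
    by (intro order_trans[OF norm_transpose_mult_le] mult_left_mono) auto
  then show ?thesis using gamma(1) by (simp add: mult.assoc)
qed

lemma norm_dual_residual:
  "norm (gv (Suc k) + gh (Suc k) + transpose B *v p (Suc k)) \<le> M * du k + L_GH * dv k"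
proof -
  have "gv (Suc k) + gh (Suc k) + transpose B *v p (Suc k) = (gv (Suc k) - gv k) + (gh (Suc k) - gh k)
      + \<gamma> *\<^sub>R (transpose B *v (\<Theta> (u (Suc k)) - \<Theta> (u k)))"
    by (simp add: dual)
  also have "norm \<dots> \<le> L_G * (du k + dv k) + L_H * dv k + N * du k"
    by (intro norm_triangle_mono norm_dgv norm_dgh norm_Bt_dTheta)
  finally show ?thesis by (simp add: algebra_simps)
qed

lemma r_in_range: "r k \<in> range ((*v) B)"
proof -
  have "\<Theta> (u k) \<in> range ((*v) B)" using range_Theta by blast
  then obtain x where "\<Theta> (u k) = B *v x" by blast
  then have "r k = B *v (x + v k)" by (simp add: matrix_vector_right_distrib)
  then show ?thesis by blast
qed

lemma dp_in_range: "p (Suc k) - p k \<in> range ((*v) B)"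
proof -
  obtain x where "r (Suc k) = B *v x" using r_in_range[of "Suc k"] by blast
  then have "p (Suc k) - p k = B *v (\<gamma> *\<^sub>R x)" by (simp add: p_eq matrix_vector_mult_scaleR)
  then show ?thesis by blast
qed

text \<open>\<open>transpose B\<close> applied to the increment is a new change of
  \<open>\<Theta>\<close> minus the dual residual of the previous step, and it can be inverted on
  the range of \<open>B\<close>. The 3 comes from squaring a sum of three terms. Two of them belong
  to the previous step, which is why a Lyapunov function with memory is needed.\<close>

lemma dp_bound: "(dp (Suc k))\<^sup>2 / \<gamma> \<le> 3 * (M\<^sup>2 / (\<gamma> * lam) * (du k)\<^sup>2
    + L_GH\<^sup>2 / (\<gamma> * lam) * (dv k)\<^sup>2 + N\<^sup>2 / (\<gamma> * lam) * (du (Suc k))\<^sup>2)"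
proof -
  have "transpose B *v (p (Suc (Suc k)) - p (Suc k)) =
      \<gamma> *\<^sub>R (transpose B *v (\<Theta> (u (Suc (Suc k))) - \<Theta> (u (Suc k))))
      - (gv (Suc k) + gh (Suc k) + transpose B *v p (Suc k))"
    by (simp add: matrix_vector_mult_diff_distrib dual[of "Suc k"] algebra_simps)
  also have "norm \<dots> \<le> N * du (Suc k) + (M * du k + L_GH * dv k)"
    by (intro order_trans[OF norm_triangle_ineq4] add_mono norm_Bt_dTheta norm_dual_residual)
  finally have *: "norm (transpose B *v (p (Suc (Suc k)) - p (Suc k)))
      \<le> M * du k + L_GH * dv k + N * du (Suc k)" by simp
  have "lam * (dp (Suc k))\<^sup>2 \<le> (norm (transpose B *v (p (Suc (Suc k)) - p (Suc k))))\<^sup>2"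
    by (rule lambda_min_le_norm_transpose[OF dp_in_range])
  also have "\<dots> \<le> (M * du k + L_GH * dv k + N * du (Suc k))\<^sup>2"
    using * by (intro power_mono) auto
  also have "\<dots> \<le> 3 * ((M * du k)\<^sup>2 + (L_GH * dv k)\<^sup>2 + (N * du (Suc k))\<^sup>2)"
    by (rule three_sum_power2_le)
  finally have "lam * (dp (Suc k))\<^sup>2 / (\<gamma> * lam)
      \<le> 3 * ((M * du k)\<^sup>2 + (L_GH * dv k)\<^sup>2 + (N * du (Suc k))\<^sup>2) / (\<gamma> * lam)"
    using gl_pos by (intro divide_right_mono) auto
  moreover have "lam * (dp (Suc k))\<^sup>2 / (\<gamma> * lam) = (dp (Suc k))\<^sup>2 / \<gamma>"
    using lam_pos by simp
  ultimately show ?thesis by (simp add: power_mult_distrib add_divide_distrib distrib_left)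
qed

section \<open>Descent of the augmented Lagrangian and the Lyapunov function\<close>

definition AL :: "nat \<Rightarrow> real" where
  "AL k = G (u k, v k) + j k + H (v k) + p k \<bullet> r k + \<gamma> / 2 * (norm (r k))\<^sup>2"

text \<open>The old iterate is the competitor in the \<open>u\<close>-subproblem, where its Bregman
  term vanishes; it must therefore be in \<open>U\<close> with finite \<open>J\<close>.\<close>

lemma u_decrease:
  assumes "u k \<in> U" "\<bar>J (u k)\<bar> \<noteq> \<infinity>"
  shows "j (Suc k) - j k + gu k \<bullet> (u (Suc k) - u k)
      + q k \<bullet> (jacobian \<Omega> (at (u k)) *v (u (Suc k) - u k)) + q k \<bullet> (\<Phi> (u (Suc k)) - \<Phi> (u k))
      + \<beta> / (2 * \<epsilon> k) * (du k)\<^sup>2 \<le> 0"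
proof -
  have "j (Suc k) + u_smooth k (u (Suc k)) \<le> j k + u_smooth k (u k)"
    using u_min[OF assms(1), of k] J_finite[of k] assms(2)
    by (cases "J (u (Suc k))"; cases "J (u k)") auto
  moreover have "bregman K (u k) (u k) = 0" by (simp add: bregman_def)
  moreover have "1 / \<epsilon> k * (\<beta> / 2 * (du k)\<^sup>2) \<le> 1 / \<epsilon> k * bregman K (u (Suc k)) (u k)"
    using eps_pos[of k] by (intro mult_left_mono strongly_convex_imp_bregman_ge K_sc K_diff) auto
  ultimately show ?thesis
    by (simp add: inner_diff_right inner_add_right matrix_vector_mult_diff_distrib algebra_simps)
qed

text \<open>The only uncontrolled increase is \<open>(dp k)\<^sup>2 / \<gamma>\<close>, caused by
  raising the multiplier along the new residual. All other terms in \<open>du k\<close> are paid by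
  strong convexity of \<open>K\<close> through \<open>\<delta> k\<close>, and those in
  \<open>dv k\<close> by the proximal term of the \<open>v\<close>-step.\<close>

lemma AL_step:
  assumes "u k \<in> U" "\<bar>J (u k)\<bar> \<noteq> \<infinity>"
  shows "AL (Suc k) - AL k \<le> (dp k)\<^sup>2 / \<gamma>
    - (3 * (N\<^sup>2 / (\<gamma> * lam)) + 7 * (M\<^sup>2 / (\<gamma> * lam)) + 1 / 2) * (du k)\<^sup>2
    + (L_GH / 2 - 7 / 16 * (\<gamma> * lam)) * (dv k)\<^sup>2"
proof -
  define T where "T = \<Theta> (u (Suc k)) - \<Theta> (u k)"
  define W where "W = B *v (v (Suc k) - v k)"
  define a where "a = (du k)\<^sup>2"
  define b where "b = (dv k)\<^sup>2"
  have r_Suc: "r (Suc k) = r k + (T + W)"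
    by (simp add: T_def W_def matrix_vector_mult_diff_distrib)
  have G_step: "G (u (Suc k), v (Suc k)) \<le> G (u k, v k) + gu k \<bullet> (u (Suc k) - u k)
      + gv k \<bullet> (v (Suc k) - v k) + L_G / 2 * (a + b)"
    using descent_lemma[OF GDERIV_grad[OF G_diff] G_lip, of "(u (Suc k), v (Suc k))" "(u k, v k)"]
    by (simp add: inner_prod_def norm_Pair a_def b_def)
  have H_step: "H (v (Suc k)) \<le> H (v k) + gh k \<bullet> (v (Suc k) - v k) + L_H / 2 * b"
    using descent_lemma[OF GDERIV_grad[OF H_diff] H_lip] by (simp add: b_def)
  have V_step: "gv k \<bullet> (v (Suc k) - v k) + gh k \<bullet> (v (Suc k) - v k) + q k \<bullet> W = - \<gamma> * (norm W)\<^sup>2"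
    using arg_cong[OF v_opt[of k], of "\<lambda>z. z \<bullet> (v (Suc k) - v k)"]
    by (simp add: inner_add_left transpose_mult_inner W_def power2_norm_eq_inner)
  have Om: "q k \<bullet> (\<Omega> (u (Suc k)) - \<Omega> (u k)) - q k \<bullet> (jacobian \<Omega> (at (u k)) *v (u (Suc k) - u k))
      \<le> norm (q k) * L_Omega / 2 * a"
    using abs_le_D1[OF componentwise_descent[OF Omega_diff Omega_lip, of "q k" "u (Suc k)" "u k"]]
    by (simp only: L_Omega a_def inner_diff_right)
  have qT: "q k \<bullet> T = q k \<bullet> (\<Omega> (u (Suc k)) - \<Omega> (u k)) + q k \<bullet> (\<Phi> (u (Suc k)) - \<Phi> (u k))"
    by (simp add: T_def Theta inner_diff_right inner_add_right)
  have p_step: "p (Suc k) \<bullet> r (Suc k) = p k \<bullet> r k + p k \<bullet> (T + W) + (dp k)\<^sup>2 / \<gamma>"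
  proof -
    have "(dp k)\<^sup>2 / \<gamma> = \<gamma> * (r (Suc k) \<bullet> r (Suc k))"
    proof -
      have "(dp k)\<^sup>2 = \<gamma>\<^sup>2 * (r (Suc k) \<bullet> r (Suc k))"
        by (simp only: p_eq[of k] add_diff_cancel_left' norm_scaleR power_mult_distrib power2_abs
            power2_norm_eq_inner)
      then show ?thesis using gamma(1) by (simp only: power2_eq_square) simp
    qed
    moreover have "p (Suc k) \<bullet> r (Suc k) = p k \<bullet> r (Suc k) + \<gamma> * (r (Suc k) \<bullet> r (Suc k))"
      by (simp only: p_eq[of k] inner_add_left inner_scaleR_left)
    ultimately show ?thesis by (simp only: r_Suc inner_add_right)
  qed
  have r_step: "\<gamma> / 2 * (norm (r (Suc k)))\<^sup>2 = \<gamma> / 2 * (norm (r k))\<^sup>2 + \<gamma> * (r k \<bullet> (T + W))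
      + \<gamma> / 2 * (norm (T + W))\<^sup>2"
    unfolding r_Suc power2_norm_eq_inner
    by (simp only: inner_add_left[of "r k" "T + W"] inner_add_right[of _ "r k" "T + W"]
        inner_commute[of "T + W" "r k"]) (simp add: field_simps)
  \<comment> \<open>The linear terms of the multiplier and of the penalty combine into
    \<open>q k\<close>, the vector used by both subproblems, so their optimality estimates apply
    directly.\<close>
  have q_step: "p k \<bullet> (T + W) + \<gamma> * (r k \<bullet> (T + W)) = q k \<bullet> T + q k \<bullet> W"
    by (simp only: q_eq inner_add_left inner_scaleR_left inner_add_right distrib_left ac_simps)
  \<comment> \<open>The uneven splitting leaves \<open>7 / 16\<close> of the decrease \<open>\<gamma> * (norm W)\<^sup>2\<close> supplied by \<open>V_step\<close>.\<close>
  have TW: "(norm (T + W))\<^sup>2 \<le> 9 * (norm T)\<^sup>2 + 9 / 8 * (norm W)\<^sup>2"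
  proof -
    have "0 \<le> (norm (8 *\<^sub>R T - W))\<^sup>2" by simp
    also have "\<dots> = 64 * (norm T)\<^sup>2 + (norm W)\<^sup>2 - 16 * (T \<bullet> W)"
      by (simp add: power2_norm_eq_inner inner_diff_left inner_diff_right inner_commute)
    finally show ?thesis
      by (simp add: power2_norm_eq_inner inner_add_left inner_add_right inner_commute)
  qed
  have T: "\<gamma> * (norm T)\<^sup>2 \<le> \<gamma> * (L_Theta\<^sup>2 * a)"
    using power_mono[OF norm_dTheta[of k], of 2] gamma(1) by (simp add: T_def a_def power_mult_distrib)
  have W: "\<gamma> * (lam * b) \<le> \<gamma> * (norm W)\<^sup>2"
    using lambda_min_le[of B "v (Suc k) - v k"] gamma(1) by (simp add: W_def b_def)
  have TW': "\<gamma> / 2 * (norm (T + W))\<^sup>2 \<le> 9 / 2 * (\<gamma> * L_Theta\<^sup>2) * a + 9 / 16 * (\<gamma> * (norm W)\<^sup>2)"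
  proof -
    have "\<gamma> * (norm (T + W))\<^sup>2 \<le> \<gamma> * (9 * (norm T)\<^sup>2 + 9 / 8 * (norm W)\<^sup>2)"
      using TW gamma(1) by (intro mult_left_mono) auto
    with T show ?thesis by (simp add: algebra_simps)
  qed
  have sum: "AL (Suc k) - AL k \<le> (dp k)\<^sup>2 / \<gamma>
      + (L_G / 2 + norm (q k) * L_Omega / 2 + 9 / 2 * (\<gamma> * L_Theta\<^sup>2)) * a - \<beta> / (2 * \<epsilon> k) * a
      + (L_GH / 2 - 7 / 16 * (\<gamma> * lam)) * b"
  proof -
    have "AL (Suc k) - AL k = (G (u (Suc k), v (Suc k)) - G (u k, v k)) + (j (Suc k) - j k)
        + (H (v (Suc k)) - H (v k)) + (dp k)\<^sup>2 / \<gamma> + (q k \<bullet> T + q k \<bullet> W) + \<gamma> / 2 * (norm (T + W))\<^sup>2"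
      unfolding AL_def using p_step r_step q_step by linarith
    also have "\<dots> \<le> (dp k)\<^sup>2 / \<gamma> + L_G / 2 * (a + b) + L_H / 2 * b + norm (q k) * L_Omega / 2 * a
        - \<beta> / (2 * \<epsilon> k) * a + 9 / 2 * (\<gamma> * L_Theta\<^sup>2) * a - 7 / 16 * (\<gamma> * (norm W)\<^sup>2)"
      using G_step H_step V_step Om qT TW' u_decrease[OF assms] unfolding a_def[symmetric] by linarith
    also have "\<dots> \<le> (dp k)\<^sup>2 / \<gamma> + L_G / 2 * (a + b) + L_H / 2 * b + norm (q k) * L_Omega / 2 * a
        - \<beta> / (2 * \<epsilon> k) * a + 9 / 2 * (\<gamma> * L_Theta\<^sup>2) * a - 7 / 16 * (\<gamma> * (lam * b))"
      using W by linarith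
    finally show ?thesis by (simp add: algebra_simps add_divide_distrib)
  qed
  define S where "S = L_G + norm (q k) * L_Omega + \<gamma> * L_Theta\<^sup>2
       + 14 * \<gamma> * nB\<^sup>2 * L_Theta\<^sup>2 / lam + 14 * M\<^sup>2 / (\<gamma> * lam) + 1"
  have "\<beta> / \<epsilon> k \<ge> \<beta> / \<delta> k"
    using eps_pos[of k] eps(3)[of k] beta by (intro divide_left_mono) auto
  moreover have "\<beta> / \<delta> k = S"
  proof -
    have "\<delta> k = \<beta> * inverse S" unfolding S_def by (rule delta)
    then show ?thesis using beta by (simp add: field_simps)
  qed
  ultimately have S_le: "S / 2 * a \<le> \<beta> / (2 * \<epsilon> k) * a"
    by (intro mult_right_mono) (auto simp: a_def field_simps)
  have N2: "14 * \<gamma> * nB\<^sup>2 * L_Theta\<^sup>2 / lam = 14 * (N\<^sup>2 / (\<gamma> * lam))"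
    using gamma(1) by (simp add: power2_eq_square)
  \<comment> \<open>The instance is \<open>x = \<gamma> * L_Theta\<^sup>2\<close>,
    \<open>y = N\<^sup>2 / (\<gamma> * lam)\<close>,
    \<open>z = M\<^sup>2 / (\<gamma> * lam)\<close>. After reserving
    \<open>3 * y + 7 * z + 1 / 2\<close>, what remains is \<open>x / 2 + 4 * y\<close>, which covers
    \<open>9 / 2 * x\<close> exactly when \<open>x \<le> y\<close>; that follows from
    \<open>lam_le\<close>.\<close>
  have abstract: "x \<le> y \<Longrightarrow> a / 2 + b / 2 + 9 / 2 * x
      \<le> (a + b + x + 14 * y + 14 * z + 1) / 2 - (3 * y + 7 * z + 1 / 2)" for a b x y z :: real
    by (simp add: field_simps)
  have M2: "14 * M\<^sup>2 / (\<gamma> * lam) = 14 * (M\<^sup>2 / (\<gamma> * lam))" by simp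
  have "\<gamma> * L_Theta\<^sup>2 * lam \<le> \<gamma> * L_Theta\<^sup>2 * nB\<^sup>2"
    using lam_le gamma(1) by (intro mult_left_mono) auto
  then have "\<gamma> * L_Theta\<^sup>2 \<le> N\<^sup>2 / (\<gamma> * lam)"
    using lam_pos gamma(1) by (simp add: field_simps power2_eq_square)
  then have "L_G / 2 + norm (q k) * L_Omega / 2 + 9 / 2 * (\<gamma> * L_Theta\<^sup>2)
      \<le> S / 2 - (3 * (N\<^sup>2 / (\<gamma> * lam)) + 7 * (M\<^sup>2 / (\<gamma> * lam)) + 1 / 2)"
    unfolding S_def N2 M2 by (rule abstract)
  then have "(L_G / 2 + norm (q k) * L_Omega / 2 + 9 / 2 * (\<gamma> * L_Theta\<^sup>2)) * a
      \<le> (S / 2 - (3 * (N\<^sup>2 / (\<gamma> * lam)) + 7 * (M\<^sup>2 / (\<gamma> * lam)) + 1 / 2)) * a"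
    by (intro mult_right_mono) (auto simp: a_def)
  with sum S_le show ?thesis unfolding a_def b_def by (simp only: left_diff_distrib)
qed

text \<open>
  The added squares pay for the term \<open>(dp (Suc k))\<^sup>2 / \<gamma>\<close> of the next step.
\<close>

definition \<Lambda> :: "nat \<Rightarrow> real" where
  "\<Lambda> k = AL (Suc k) + 3 * (M\<^sup>2 / (\<gamma> * lam)) * (du k)\<^sup>2 + 3 * (L_GH\<^sup>2 / (\<gamma> * lam)) * (dv k)\<^sup>2"

lemma L_GH_sq: "L_GH\<^sup>2 / (\<gamma> * lam) \<le> \<gamma> * lam / 16"
  using constants_nonneg gl_pos gamma_lam by (intro power2_div_le) auto

text \<open>With \<open>c = \<gamma> * lam\<close>, the coefficient of
  \<open>(dv (Suc k))\<^sup>2\<close> is at most \<open>(2 + 3 - 7) / 16 * c\<close>: curvature,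
  added square and proximal decrease. For \<open>(du (Suc k))\<^sup>2\<close>, the \<open>N\<close>
  terms of \<open>AL_step\<close> and \<open>dp_bound\<close> cancel and the reserve of 7 multiples
  covers the added 3.\<close>

lemma Lyapunov_step: "\<Lambda> (Suc k) + (1 / 2 * (du (Suc k))\<^sup>2 + \<gamma> * lam / 8 * (dv (Suc k))\<^sup>2) \<le> \<Lambda> k"
proof -
  define c where "c = \<gamma> * lam"
  define A1 where "A1 = M\<^sup>2 / (\<gamma> * lam)"
  define A2 where "A2 = N\<^sup>2 / (\<gamma> * lam)"
  define A3 where "A3 = L_GH\<^sup>2 / (\<gamma> * lam)"
  define a where "a = (du (Suc k))\<^sup>2"
  define b where "b = (dv (Suc k))\<^sup>2"
  have "AL (Suc (Suc k)) - AL (Suc k) \<le> (dp (Suc k))\<^sup>2 / \<gamma> - (3 * A2 + 7 * A1 + 1 / 2) * a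
      + (L_GH / 2 - 7 / 16 * c) * b"
    unfolding A1_def A2_def a_def b_def c_def by (rule AL_step[OF u_in_U J_finite])
  also have "\<dots> = (dp (Suc k))\<^sup>2 / \<gamma> - 3 * (A2 * a) - 7 * (A1 * a) - a / 2
      + L_GH / 2 * b - 7 / 16 * (c * b)" by (simp add: algebra_simps)
  finally have AL: "AL (Suc (Suc k)) - AL (Suc k) \<le> \<dots>" .
  have dp: "(dp (Suc k))\<^sup>2 / \<gamma> \<le> 3 * (A1 * (du k)\<^sup>2 + A3 * (dv k)\<^sup>2 + A2 * a)"
    unfolding A1_def A2_def A3_def a_def by (rule dp_bound)
  have "(L_GH / 2 + 3 * A3) * b \<le> (5 / 16 * c) * b"
  proof (rule mult_right_mono)
    show "L_GH / 2 + 3 * A3 \<le> 5 / 16 * c"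
      using gamma_lam L_GH_sq unfolding A3_def c_def by linarith
  qed (simp add: b_def)
  then have v_coeff: "L_GH / 2 * b + 3 * (A3 * b) \<le> 5 / 16 * (c * b)" by (simp add: algebra_simps)
  have "0 \<le> A1 * a" using gl_pos by (simp add: A1_def a_def)
  with AL dp v_coeff
  have "AL (Suc (Suc k)) + 3 * (A1 * a) + 3 * (A3 * b) + (a / 2 + c * b / 8)
      \<le> AL (Suc k) + 3 * (A1 * (du k)\<^sup>2) + 3 * (A3 * (dv k)\<^sup>2)"
    unfolding distrib_left by linarith
  then show ?thesis
    unfolding \<Lambda>_def A1_def A3_def a_def b_def c_def by simp
qed


section \<open>Feasible companion points and the lower bound\<close>

lemma ex_feasible: "\<exists>y. \<Theta> (u k) + B *v y = 0"
proof -
  have "\<Theta> (u k) \<in> range ((*v) B)" using range_Theta by blast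
  then obtain x where "\<Theta> (u k) = B *v x" by blast
  then have "\<Theta> (u k) + B *v (- x) = B *v (x + - x)"
    by (simp only: matrix_vector_right_distrib)
  then show ?thesis by auto
qed

definition vh :: "nat \<Rightarrow> real^'d" where
  "vh k = (SOME y. \<Theta> (u k) + B *v y = 0)"

lemma vh: "\<Theta> (u k) + B *v vh k = 0"
  unfolding vh_def using ex_feasible by (rule someI_ex)

definition Fh :: "nat \<Rightarrow> real" where
  "Fh k = G (u k, vh k) + j k + H (vh k)"

text \<open>
  Feasibility of \<open>(u k, vh k)\<close> gives \<open>B *v (v k - vh k) = r k\<close>, so the multiplier only acts through
  \<open>transpose B *v p k\<close>, which is the negative gradient in \<open>v\<close> up to a small residual.
\<close>

lemma Fh_le_Lyapunov: "Fh (Suc k) \<le> \<Lambda> k"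
proof -
  define z where "z = v (Suc k) - vh (Suc k)"
  define c where "c = \<gamma> * lam"
  define X where "X = gv (Suc k) + gh (Suc k) + transpose B *v p (Suc k)"
  define A1 where "A1 = M\<^sup>2 / c * (du k)\<^sup>2"
  define A3 where "A3 = L_GH\<^sup>2 / c * (dv k)\<^sup>2"
  have c: "0 < c" "4 * L_GH \<le> c" using gl_pos gamma_lam by (simp_all add: c_def)
  have Bz: "B *v z = r (Suc k)"
    using vh[of "Suc k"] by (simp add: z_def matrix_vector_mult_diff_distrib add_eq_0_iff2)
  let ?g = "\<lambda>y. snd (grad G (u (Suc k), y)) + grad H y"
  have "G (u (Suc k), vh (Suc k)) + H (vh (Suc k))
      \<le> G (u (Suc k), v (Suc k)) + H (v (Suc k)) + ?g (v (Suc k)) \<bullet> (vh (Suc k) - v (Suc k))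
        + L_GH / 2 * (norm (vh (Suc k) - v (Suc k)))\<^sup>2"
  proof (rule descent_lemma)
    show "GDERIV (\<lambda>y. G (u (Suc k), y) + H y) y :> ?g y" for y
      using GDERIV_partial_snd[OF G_diff, of "u (Suc k)" y] GDERIV_grad[OF H_diff, of y]
      unfolding gderiv_def inner_add_right by (rule has_derivative_add)
    show "L_GH-lipschitz_on UNIV ?g"
    proof (intro lipschitz_on_add H_lip lipschitz_onI)
      fix x y
      have "norm (snd (grad G (u (Suc k), x)) - snd (grad G (u (Suc k), y)))
          \<le> norm (grad G (u (Suc k), x) - grad G (u (Suc k), y))"
        using norm_snd_le[of "snd (grad G (u (Suc k), x) - grad G (u (Suc k), y))"
            "fst (grad G (u (Suc k), x) - grad G (u (Suc k), y))"]
        unfolding prod.collapse by (simp only: snd_diff)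
      also have "\<dots> \<le> L_G * norm (x - y)"
        using lipschitz_onD[OF G_lip, of "(u (Suc k), x)" "(u (Suc k), y)"]
        by (simp add: dist_norm norm_Pair)
      finally show "dist (snd (grad G (u (Suc k), x))) (snd (grad G (u (Suc k), y))) \<le> L_G * dist x y"
        by (simp add: dist_norm)
    qed (rule constants_nonneg)
  qed
  then have f: "G (u (Suc k), vh (Suc k)) + H (vh (Suc k)) \<le> G (u (Suc k), v (Suc k)) + H (v (Suc k))
      - (gv (Suc k) + gh (Suc k)) \<bullet> z + L_GH / 2 * (norm z)\<^sup>2"
    unfolding z_def by (simp add: inner_diff_right norm_minus_commute)
  have pr: "p (Suc k) \<bullet> r (Suc k) = (transpose B *v p (Suc k)) \<bullet> z"
    by (simp only: transpose_mult_inner Bz)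
  have rr: "c / 2 * (norm z)\<^sup>2 \<le> \<gamma> / 2 * (norm (r (Suc k)))\<^sup>2"
    using mult_left_mono[OF lambda_min_le[of B z], of "\<gamma> / 2"] gamma(1) by (simp add: c_def Bz)
  \<comment> \<open>The penalty supplies \<open>c / 2 * (norm z)\<^sup>2\<close>: one half of it
    covers the curvature of \<open>G\<close> and \<open>H\<close> in \<open>v\<close>, the other
    half the pairing of \<open>z\<close> with the residual \<open>X\<close> by Young's inequality.
    The leftover \<open>(norm X)\<^sup>2 / c\<close> is within the squares added in
    \<open>\<Lambda>\<close>.\<close>
  have "L_GH / 2 * (norm z)\<^sup>2 \<le> c / 4 * (norm z)\<^sup>2"
    using c by (intro mult_right_mono) auto
  moreover have "- (X \<bullet> z) \<le> c / 4 * (norm z)\<^sup>2 + (norm X)\<^sup>2 / c"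
  proof -
    have "0 \<le> (c * norm z / 2 - norm X)\<^sup>2 / c" using c by simp
    also have "\<dots> = c / 4 * (norm z)\<^sup>2 + (norm X)\<^sup>2 / c - norm X * norm z"
      using c(1) by (simp add: power2_eq_square field_simps)
    finally show ?thesis using norm_cauchy_schwarz[of "- X" z] by simp
  qed
  moreover have "(norm X)\<^sup>2 / c \<le> 2 * A1 + 2 * A3"
  proof -
    have "(norm X)\<^sup>2 \<le> (M * du k + L_GH * dv k)\<^sup>2"
      unfolding X_def by (intro power_mono norm_dual_residual) auto
    also have "\<dots> \<le> 2 * ((M * du k)\<^sup>2 + (L_GH * dv k)\<^sup>2)"
      by (rule two_sum_power2_le)
    finally have "(norm X)\<^sup>2 / c \<le> 2 * ((M * du k)\<^sup>2 + (L_GH * dv k)\<^sup>2) / c"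
      using c(1) by (intro divide_right_mono) auto
    then show ?thesis by (simp add: A1_def A3_def power_mult_distrib add_divide_distrib distrib_left)
  qed
  moreover have "0 \<le> A1" "0 \<le> A3" using c(1) by (simp_all add: A1_def A3_def)
  moreover have "(gv (Suc k) + gh (Suc k)) \<bullet> z + (transpose B *v p (Suc k)) \<bullet> z = X \<bullet> z"
    by (simp add: X_def inner_add_left)
  moreover have "\<Lambda> k = AL (Suc k) + 3 * A1 + 3 * A3"
    by (simp add: \<Lambda>_def A1_def A3_def c_def)
  ultimately show ?thesis
    using f rr unfolding Fh_def AL_def pr by linarith
qed

lemma Lyapunov_antimono: "\<Lambda> k \<le> \<Lambda> 0"
proof (induction k)
  case (Suc k)
  have "0 \<le> 1 / 2 * (du (Suc k))\<^sup>2 + \<gamma> * lam / 8 * (dv (Suc k))\<^sup>2" using gl_pos by simp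
  then show ?case using Suc Lyapunov_step[of k] by linarith
qed simp

lemma objective_Fh: "objective G J H (u (Suc k), vh (Suc k)) = ereal (Fh (Suc k))"
  using J_finite[of k] by (cases "J (u (Suc k))") (auto simp: objective_def Fh_def)

section \<open>Square summability and boundedness of the run\<close>

lemma summable_sq_du: "summable (\<lambda>k. (du k)\<^sup>2)" and summable_sq_dv: "summable (\<lambda>k. (dv k)\<^sup>2)"
proof -
  obtain c where c: "\<forall>z \<in> {(x, y). \<Theta> x + B *v y = 0}. ereal c \<le> objective G J H z"
    using bounded_below by blast
  have "c \<le> Fh (Suc k)" for k
    using bspec[OF c, of "(u (Suc k), vh (Suc k))"] vh[of "Suc k"] by (simp add: objective_Fh)
  then have low: "c \<le> \<Lambda> k" for k using Fh_le_Lyapunov order_trans by blast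
  let ?b = "\<lambda>k. 1 / 2 * (du (Suc k))\<^sup>2 + \<gamma> * lam / 8 * (dv (Suc k))\<^sup>2"
  have sum: "summable ?b"
    by (rule summable_if_telescoping_bound[where \<Lambda> = \<Lambda> and c = c])
      (use gl_pos low Lyapunov_step in auto)
  have "summable (\<lambda>k. (du (Suc k))\<^sup>2)"
  proof (rule summable_comparison_test'[OF summable_mult[OF sum, of 2]])
    fix k
    have "0 \<le> \<gamma> * lam / 8 * (dv (Suc k))\<^sup>2" using gl_pos by simp
    then show "norm ((du (Suc k))\<^sup>2) \<le> 2 * ?b k" by simp
  qed
  then show "summable (\<lambda>k. (du k)\<^sup>2)" by (subst (asm) summable_Suc_iff)
  have "summable (\<lambda>k. (dv (Suc k))\<^sup>2)"
  proof (rule summable_comparison_test'[OF summable_mult[OF sum, of "8 / (\<gamma> * lam)"]])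
    fix k
    show "norm ((dv (Suc k))\<^sup>2) \<le> 8 / (\<gamma> * lam) * ?b k"
      using gamma(1) lam_pos by (simp add: distrib_left)
  qed
  then show "summable (\<lambda>k. (dv k)\<^sup>2)" by (subst (asm) summable_Suc_iff)
qed

lemma summable_sq_dp: "summable (\<lambda>k. (dp k)\<^sup>2)"
proof -
  let ?b = "\<lambda>k. 3 * (M\<^sup>2 / (\<gamma> * lam) * (du k)\<^sup>2
    + L_GH\<^sup>2 / (\<gamma> * lam) * (dv k)\<^sup>2 + N\<^sup>2 / (\<gamma> * lam) * (du (Suc k))\<^sup>2)"
  have "summable (\<lambda>k. (du (Suc k))\<^sup>2)" using summable_sq_du by (subst summable_Suc_iff)
  then have sum: "summable ?b"
    by (intro summable_mult summable_add summable_sq_du summable_sq_dv)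
  have "summable (\<lambda>k. (dp (Suc k))\<^sup>2)"
  proof (rule summable_comparison_test'[OF summable_mult[OF sum, of \<gamma>]])
    fix k
    have "\<gamma> * ((dp (Suc k))\<^sup>2 / \<gamma>) \<le> \<gamma> * ?b k"
      using gamma(1) by (intro mult_left_mono dp_bound) auto
    then show "norm ((dp (Suc k))\<^sup>2) \<le> \<gamma> * ?b k" using gamma(1) by simp
  qed
  then show ?thesis by (subst (asm) summable_Suc_iff)
qed

text \<open>Coercivity holds only on the feasible set, so it bounds \<open>(u k, vh k)\<close> and
  not \<open>(u k, v k)\<close>. The distance from \<open>v k\<close> to \<open>vh k\<close> is
  controlled by the residual, that is by the multiplier increment, whose squares are
  summable.\<close>

lemma Bseq_u: "Bseq u" and Bseq_v: "Bseq v"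
proof -
  have "\<forall>\<^sub>F z in at_infinity. z \<in> {(x, y). \<Theta> x + B *v y = 0} \<longrightarrow> ereal (\<Lambda> 0) < objective G J H z"
    using coercive unfolding coercive_on_def tendsto_PInfty eventually_inf_principal by blast
  then obtain R where R: "\<And>z. R \<le> norm z \<Longrightarrow> z \<in> {(x, y). \<Theta> x + B *v y = 0} \<Longrightarrow>
      ereal (\<Lambda> 0) < objective G J H z"
    unfolding eventually_at_infinity by blast
  have bnd: "norm (u (Suc k), vh (Suc k)) \<le> R" for k
  proof (rule ccontr)
    assume "\<not> ?thesis"
    then have "ereal (\<Lambda> 0) < objective G J H (u (Suc k), vh (Suc k))"
      by (intro R) (use vh in auto)
    then show False using Fh_le_Lyapunov[of k] Lyapunov_antimono[of k] by (simp add: objective_Fh)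
  qed
  have "norm (u (Suc k)) \<le> R" for k using norm_fst_le bnd order_trans by blast
  then have "Bseq (\<lambda>k. u (Suc k))" by (rule BseqI')
  then show "Bseq u" by (simp only: Bseq_Suc_iff)
  obtain D where D: "\<And>k. (dp k)\<^sup>2 \<le> D" using summable_imp_bounded_terms[OF summable_sq_dp] by blast
  have "norm (v (Suc k)) \<le> R + sqrt (D / (\<gamma>\<^sup>2 * lam))" for k
  proof -
    have "B *v (v (Suc k) - vh (Suc k)) = r (Suc k)"
      using vh[of "Suc k"] by (simp add: matrix_vector_mult_diff_distrib add_eq_0_iff2)
    then have "lam * (norm (v (Suc k) - vh (Suc k)))\<^sup>2 \<le> (norm (r (Suc k)))\<^sup>2"
      using lambda_min_le[of B "v (Suc k) - vh (Suc k)"] by simp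
    moreover have "(dp k)\<^sup>2 = \<gamma>\<^sup>2 * (norm (r (Suc k)))\<^sup>2"
      by (simp only: p_eq[of k] add_diff_cancel_left' norm_scaleR power_mult_distrib power2_abs)
    ultimately have "(\<gamma>\<^sup>2 * lam) * (norm (v (Suc k) - vh (Suc k)))\<^sup>2 \<le> D"
      using D[of k] mult_left_mono[of "lam * (norm (v (Suc k) - vh (Suc k)))\<^sup>2" "(norm (r (Suc k)))\<^sup>2" "\<gamma>\<^sup>2"]
      by (simp add: mult.assoc)
    then have "(norm (v (Suc k) - vh (Suc k)))\<^sup>2 \<le> D / (\<gamma>\<^sup>2 * lam)"
      using gamma(1) lam_pos by (simp add: pos_le_divide_eq mult.commute)
    then have "norm (v (Suc k) - vh (Suc k)) \<le> sqrt (D / (\<gamma>\<^sup>2 * lam))" by (rule real_le_rsqrt)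
    moreover have "norm (vh (Suc k)) \<le> R" using norm_snd_le bnd order_trans by blast
    ultimately show ?thesis using norm_triangle_sub[of "v (Suc k)" "vh (Suc k)"] by linarith
  qed
  then have "Bseq (\<lambda>k. v (Suc k))" by (rule BseqI')
  then show "Bseq v" by (simp only: Bseq_Suc_iff)
qed

lemma p_minus_p0_in_range: "p k - p 0 \<in> range ((*v) B)"
proof (induction k)
  case 0
  show ?case by (simp add: image_iff) (metis matrix_vector_mult_0_right)
next
  case (Suc k)
  obtain x y where "p k - p 0 = B *v x" "p (Suc k) - p k = B *v y"
    using Suc dp_in_range[of k] by blast
  then have "p (Suc k) - p 0 = B *v (x + y)"
    by (metis diff_add_cancel add_diff_eq add.commute matrix_vector_right_distrib)
  then show ?case by blast
qed

text \<open>By \<open>dual\<close>, \<open>transpose B *v p (Suc k)\<close> is bounded along bounded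
  iterates. The arbitrary \<open>p 0\<close> may have a part outside the range of \<open>B\<close>
  that the transpose does not see, so the eigenvalue bound is applied to
  \<open>p (Suc k) - p 0\<close>.\<close>

lemma Bseq_p: "Bseq p"
proof -
  obtain Ru where Ru: "\<And>k. norm (u k) \<le> Ru" using Bseq_u unfolding Bseq_def by blast
  obtain RG where RG: "\<And>k. norm (grad G (u k, v k)) \<le> RG"
    using Bseq_lipschitz_comp[OF G_lip Bseq_Pair[OF Bseq_u Bseq_v]] unfolding Bseq_def by blast
  obtain RH where RH: "\<And>k. norm (grad H (v k)) \<le> RH"
    using Bseq_lipschitz_comp[OF H_lip Bseq_v] unfolding Bseq_def by blast
  define C where "C = RG + RH + N * (Ru + Ru) + norm (transpose B *v p 0)"
  have "norm (p (Suc k)) \<le> norm (p 0) + sqrt (C\<^sup>2 / lam)" for k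
  proof -
    have "norm (gv k) \<le> RG"
      using RG[of k] norm_snd_le[of "gv k" "gu k"] by simp
    moreover have "norm (\<gamma> *\<^sub>R (transpose B *v (\<Theta> (u (Suc k)) - \<Theta> (u k)))) \<le> N * (Ru + Ru)"
    proof -
      have "du k \<le> Ru + Ru" using Ru norm_triangle_le_diff add_mono by blast
      then have "N * du k \<le> N * (Ru + Ru)"
        using constants_nonneg gamma(1) by (intro mult_left_mono) auto
      with norm_Bt_dTheta[of k] show ?thesis by linarith
    qed
    moreover have eq: "transpose B *v (p (Suc k) - p 0) = - gv k - gh k
        + \<gamma> *\<^sub>R (transpose B *v (\<Theta> (u (Suc k)) - \<Theta> (u k))) - transpose B *v p 0"
      by (simp add: matrix_vector_mult_diff_distrib dual)
    ultimately have "norm (transpose B *v (p (Suc k) - p 0)) \<le> C" unfolding eq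
      using RH[of k] norm_triangle_ineq4[of "- gv k - gh k
        + \<gamma> *\<^sub>R (transpose B *v (\<Theta> (u (Suc k)) - \<Theta> (u k)))" "transpose B *v p 0"]
        norm_triangle_ineq[of "- gv k - gh k" "\<gamma> *\<^sub>R (transpose B *v (\<Theta> (u (Suc k)) - \<Theta> (u k)))"]
        norm_triangle_ineq4[of "- gv k" "gh k"]
      unfolding C_def norm_minus_cancel by linarith
    then have "(norm (transpose B *v (p (Suc k) - p 0)))\<^sup>2 \<le> C\<^sup>2" by (intro power_mono) auto
    then have "lam * (norm (p (Suc k) - p 0))\<^sup>2 \<le> C\<^sup>2"
      using lambda_min_le_norm_transpose[OF p_minus_p0_in_range] order_trans by blast
    then have "(norm (p (Suc k) - p 0))\<^sup>2 \<le> C\<^sup>2 / lam"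
      using lam_pos by (simp add: pos_le_divide_eq mult.commute)
    then have "norm (p (Suc k) - p 0) \<le> sqrt (C\<^sup>2 / lam)" by (rule real_le_rsqrt)
    then show ?thesis using norm_triangle_sub[of "p (Suc k)" "p 0"] by linarith
  qed
  then have "Bseq (\<lambda>k. p (Suc k))" by (rule BseqI')
  then show ?thesis by (simp only: Bseq_Suc_iff)
qed

text \<open>The predicted step in \<open>q (Suc k)\<close> uses the same residual as the step just
  taken, so \<open>q\<close> is an extrapolation of \<open>p\<close> and inherits its
  bounds.\<close>

lemma q_Suc: "q (Suc k) = 2 *\<^sub>R p (Suc k) - p k"
proof -
  have "\<gamma> *\<^sub>R r (Suc k) = p (Suc k) - p k" by (simp only: p_eq[of k] add_diff_cancel_left')
  then have "q (Suc k) = p (Suc k) + (p (Suc k) - p k)" by (simp only: q_eq)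
  then show ?thesis by (simp add: scaleR_2)
qed

lemma Bseq_q: "Bseq q"
proof -
  obtain R where R: "\<And>k. norm (p k) \<le> R" using Bseq_p unfolding Bseq_def by blast
  have "norm (q (Suc k)) \<le> 2 * R + R" for k
    unfolding q_Suc using R[of k] R[of "Suc k"]
    by (intro order_trans[OF norm_triangle_ineq4] add_mono) auto
  then have "Bseq (\<lambda>k. q (Suc k))" by (rule BseqI')
  then show ?thesis by (simp only: Bseq_Suc_iff)
qed

text \<open>The lower bound \<open>\<sigma> * \<delta> k\<close> on \<open>\<epsilon> k\<close> acts
  here: bounded \<open>q\<close> bounds the reciprocal of \<open>\<delta> k\<close>, so the proximal
  gradient in the \<open>u\<close>-optimality condition is of the order of
  \<open>du k\<close>.\<close>

lemma inverse_eps_bounded: obtains E where "\<And>k. 1 / \<epsilon> k \<le> E" "0 \<le> E"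
proof -
  obtain Q where Q: "\<And>k. norm (q k) \<le> Q" using Bseq_q unfolding Bseq_def by blast
  define rest where "rest = \<gamma> * L_Theta\<^sup>2 + 14 * \<gamma> * nB\<^sup>2 * L_Theta\<^sup>2 / lam
    + 14 * M\<^sup>2 / (\<gamma> * lam) + 1"
  have bnd: "1 / \<epsilon> k \<le> (L_G + Q * L_Omega + rest) / (\<sigma> * \<beta>)" for k
  proof -
    have d: "\<delta> k = \<beta> * inverse (L_G + norm (q k) * L_Omega + rest)"
      using delta[of k] by (simp add: rest_def add.assoc)
    have "1 / \<epsilon> k \<le> 1 / (\<sigma> * \<delta> k)"
      using eps[of k] sigma eps_pos[of k] by (intro divide_left_mono) auto
    also have "\<dots> = (L_G + norm (q k) * L_Omega + rest) / (\<sigma> * \<beta>)"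
      unfolding d by (simp add: divide_inverse)
    also have "\<dots> \<le> (L_G + Q * L_Omega + rest) / (\<sigma> * \<beta>)"
      using Q[of k] constants_nonneg sigma beta
      by (intro divide_right_mono add_mono mult_right_mono) auto
    finally show ?thesis .
  qed
  have "0 \<le> (L_G + Q * L_Omega + rest) / (\<sigma> * \<beta>)"
    using bnd[of 0] eps_pos[of 0] by (meson divide_nonneg_pos order_trans zero_le_one)
  with bnd show ?thesis by (rule that)
qed

section \<open>Subgradients of the augmented Lagrangian along the run\<close>

text \<open>For \<open>U = UNIV\<close> there is no constraint to separate from \<open>J\<close>, so
  the Frechet rule works with normal 0 and no Lipschitz property of \<open>J\<close>. For a proper
  subset the local Lipschitz assumption makes \<open>constrained_fermat\<close> applicable.\<close>

lemma u_optimality: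
  obtains \<zeta> \<nu> where "\<zeta> \<in> limiting_subdiff J (u (Suc k))" "\<nu> \<in> normal_cone U (u (Suc k))"
    "\<zeta> + \<nu> = - (gu k + transpose (jacobian \<Omega> (at (u k))) *v q k
      + transpose (jacobian \<Phi> (at (u (Suc k)))) *v q k
      + (1 / \<epsilon> k) *\<^sub>R (grad K (u (Suc k)) - grad K (u k)))"
proof -
  define D where "D = gu k + transpose (jacobian \<Omega> (at (u k))) *v q k
      + transpose (jacobian \<Phi> (at (u (Suc k)))) *v q k
      + (1 / \<epsilon> k) *\<^sub>R (grad K (u (Suc k)) - grad K (u k))"
  have der: "GDERIV (u_smooth k) (u (Suc k)) :> D"
  proof -
    have dO: "((\<lambda>x. jacobian \<Omega> (at (u k)) *v x) has_derivative (\<lambda>h. jacobian \<Omega> (at (u k)) *v h)) (at (u (Suc k)))"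
      by (rule bounded_linear.has_derivative[OF matrix_vector_mul_bounded_linear]) auto
    have dP: "(\<Phi> has_derivative (\<lambda>h. jacobian \<Phi> (at (u (Suc k))) *v h)) (at (u (Suc k)))"
      using Phi_diff by (simp add: jacobian_works)
    have dK: "(K has_derivative (\<lambda>h. h \<bullet> grad K (u (Suc k)))) (at (u (Suc k)))"
      using GDERIV_grad[OF K_diff] by (simp add: gderiv_def)
    have "(u_smooth k has_derivative (\<lambda>h. gu k \<bullet> h
        + q k \<bullet> (jacobian \<Omega> (at (u k)) *v h + jacobian \<Phi> (at (u (Suc k))) *v h)
        + 1 / \<epsilon> k * (h \<bullet> grad K (u (Suc k)) - grad K (u k) \<bullet> h))) (at (u (Suc k)))"
      unfolding bregman_def using eps_pos[of k] by (auto intro!: derivative_eq_intros dO dP dK)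
    moreover have "gu k \<bullet> h
        + q k \<bullet> (jacobian \<Omega> (at (u k)) *v h + jacobian \<Phi> (at (u (Suc k))) *v h)
        + 1 / \<epsilon> k * (h \<bullet> grad K (u (Suc k)) - grad K (u k) \<bullet> h) = h \<bullet> D" for h
    proof -
      have "h \<bullet> D = gu k \<bullet> h + (transpose (jacobian \<Omega> (at (u k))) *v q k) \<bullet> h
        + (transpose (jacobian \<Phi> (at (u (Suc k)))) *v q k) \<bullet> h
        + 1 / \<epsilon> k * (h \<bullet> grad K (u (Suc k)) - grad K (u k) \<bullet> h)"
        by (simp add: D_def inner_add_right inner_diff_right inner_commute)
      then show ?thesis by (simp add: transpose_mult_inner inner_add_right)
    qed
    ultimately show ?thesis by (simp add: gderiv_def)
  qed
  show ?thesis
  proof (cases "U = UNIV")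
    case True
    have "- D \<in> frechet_subdiff J (u (Suc k))"
      by (rule frechet_subdiffI[where f = J and x = "u (Suc k)" and S = UNIV, OF J_finite der]) (use u_min True in auto)
    then have "- D \<in> limiting_subdiff J (u (Suc k))" using frechet_subset_limiting by blast
    moreover have "0 \<in> normal_cone U (u (Suc k))" by (simp add: normal_cone_def)
    ultimately show ?thesis using that[of "- D" 0] by (simp add: D_def)
  next
    case False
    have "u (Suc k) \<in> eff_dom J \<inter> U"
      using J_finite[of k] u_in_U[of k] by (cases "J (u (Suc k))") (auto simp: eff_dom_def)
    then have "locally_lipschitz_around J (u (Suc k))" by (rule J_lip[OF False])
    then obtain \<zeta> \<nu> where "\<zeta> \<in> limiting_subdiff J (u (Suc k))" "\<nu> \<in> normal_cone U (u (Suc k))"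
      "\<zeta> + \<nu> = - D"
      by (rule constrained_fermat[where a = "u (Suc k)" and g = "u_smooth k", OF U u_in_U _ der u_min])
    then show ?thesis using that by (simp add: D_def)
  qed
qed

text \<open>The multiplier in \<open>al_subdiff\<close> at step \<open>k + 1\<close> is exactly
  \<open>q (Suc k)\<close>, whereas the optimality conditions carry \<open>q k\<close>. The
  subgradient and normal are already taken at the new point, so only changes of smooth terms and of
  \<open>q\<close> remain, plus the constraint residual \<open>dp k / \<gamma>\<close>.\<close>

lemma edist_subdiff_bound:
  obtains C where "0 \<le> C" "\<And>k. edist 0 (al_subdiff G J H \<Theta> B U \<gamma> (u (Suc k), v (Suc k), p (Suc k)))
    \<le> ereal (C * (du k + dv k + norm (q (Suc k) - q k) + dp k))"
proof -
  obtain Q where Q: "\<And>k. norm (q k) \<le> Q" using Bseq_q unfolding Bseq_def by blast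
  obtain E where E: "\<And>k. 1 / \<epsilon> k \<le> E" "0 \<le> E" using inverse_eps_bounded by blast
  have Q0: "0 \<le> Q" using Q[of 0] norm_ge_zero order_trans by blast
  define C where "C = 2 * L_G + L_Theta + Q * L_Omega + E * L_K + L_H + nB + \<gamma> * nB\<^sup>2 + 1 / \<gamma>"
  note nonneg = constants_nonneg gamma(1) Q0 E(2)
  have "edist 0 (al_subdiff G J H \<Theta> B U \<gamma> (u (Suc k), v (Suc k), p (Suc k)))
    \<le> ereal (C * (du k + dv k + norm (q (Suc k) - q k) + dp k))" for k
  proof -
    define e where "e = norm (q (Suc k) - q k)"
    obtain \<zeta> \<nu> where \<zeta>: "\<zeta> \<in> limiting_subdiff J (u (Suc k))" and \<nu>: "\<nu> \<in> normal_cone U (u (Suc k))"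
      and opt: "\<zeta> + \<nu> = - (gu k + transpose (jacobian \<Omega> (at (u k))) *v q k
        + transpose (jacobian \<Phi> (at (u (Suc k)))) *v q k
        + (1 / \<epsilon> k) *\<^sub>R (grad K (u (Suc k)) - grad K (u k)))"
      by (rule u_optimality)
    define x where "x = gu (Suc k) + \<zeta> + \<nu> + transpose (jacobian \<Theta> (at (u (Suc k)))) *v q (Suc k)"
    define y where "y = gv (Suc k) + gh (Suc k) + transpose B *v q (Suc k)"
    have mem: "(x, y, r (Suc k)) \<in> al_subdiff G J H \<Theta> B U \<gamma> (u (Suc k), v (Suc k), p (Suc k))"
      unfolding al_subdiff_def x_def y_def grad_G_fst grad_G_snd q_eq using \<zeta> \<nu> by auto
    have \<Theta>_split: "transpose (jacobian \<Theta> (at (u (Suc k)))) *v q k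
        = transpose (jacobian \<Omega> (at (u (Suc k)))) *v q k + transpose (jacobian \<Phi> (at (u (Suc k)))) *v q k"
      unfolding Theta jacobian_add[OF Omega_diff Phi_diff] by (rule transpose_add_mult)
    have x_eq: "x = (gu (Suc k) - gu k) + transpose (jacobian \<Theta> (at (u (Suc k)))) *v (q (Suc k) - q k)
        + (transpose (jacobian \<Omega> (at (u (Suc k)))) *v q k - transpose (jacobian \<Omega> (at (u k))) *v q k)
        - (1 / \<epsilon> k) *\<^sub>R (grad K (u (Suc k)) - grad K (u k))"
      using opt unfolding x_def matrix_vector_mult_diff_distrib \<Theta>_split
      by (simp add: algebra_simps)
    have x: "norm x \<le> L_G * (du k + dv k) + L_Theta * e + Q * L_Omega * du k + E * L_K * du k"
      unfolding x_eq
    proof (rule order_trans[OF norm_triangle_ineq4], rule add_mono, rule norm_triangle_mono,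
        rule norm_triangle_mono, rule norm_dgu)
      show "norm (transpose (jacobian \<Theta> (at (u (Suc k)))) *v (q (Suc k) - q k)) \<le> L_Theta * e"
        unfolding e_def using Omega_diff Phi_diff
        by (intro norm_transpose_jacobian_le Theta_lip) (simp add: Theta)
      have "norm (transpose (jacobian \<Omega> (at (u (Suc k)))) *v q k - transpose (jacobian \<Omega> (at (u k))) *v q k)
          \<le> norm (q k) * L_Omega * du k"
        unfolding L_Omega by (rule norm_transpose_jacobian_diff_le[OF Omega_diff Omega_lip])
      also have "\<dots> \<le> Q * L_Omega * du k"
        using Q nonneg by (intro mult_right_mono) auto
      finally show "norm (transpose (jacobian \<Omega> (at (u (Suc k)))) *v q k - transpose (jacobian \<Omega> (at (u k))) *v q k)
          \<le> Q * L_Omega * du k" .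
      have "norm (grad K (u (Suc k)) - grad K (u k)) \<le> L_K * du k"
        using lipschitz_onD[OF K_lip, of "u (Suc k)" "u k"] by (simp add: dist_norm)
      then have "1 / \<epsilon> k * norm (grad K (u (Suc k)) - grad K (u k)) \<le> E * (L_K * du k)"
        using E nonneg by (intro mult_mono) auto
      then show "norm ((1 / \<epsilon> k) *\<^sub>R (grad K (u (Suc k)) - grad K (u k))) \<le> E * L_K * du k"
        using eps_pos[of k] by (simp add: mult.assoc)
    qed
    have "y = (gv (Suc k) - gv k) + (gh (Suc k) - gh k) + transpose B *v (q (Suc k) - q k)
        - \<gamma> *\<^sub>R (transpose B *v (B *v (v (Suc k) - v k)))
        + (gv k + gh k + transpose B *v q k + \<gamma> *\<^sub>R (transpose B *v (B *v (v (Suc k) - v k))))"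
      unfolding y_def matrix_vector_mult_diff_distrib[of "transpose B" "q (Suc k)" "q k"]
      by (rule telescope_sum3)
    then have y_eq: "y = (gv (Suc k) - gv k) + (gh (Suc k) - gh k) + transpose B *v (q (Suc k) - q k)
        - \<gamma> *\<^sub>R (transpose B *v (B *v (v (Suc k) - v k)))" by (simp only: v_opt add_0_right)
    have y: "norm y \<le> L_G * (du k + dv k) + L_H * dv k + nB * e + \<gamma> * nB\<^sup>2 * dv k"
      unfolding y_eq
    proof (rule order_trans[OF norm_triangle_ineq4], rule add_mono, rule norm_triangle_mono,
        rule norm_triangle_mono, rule norm_dgv, rule norm_dgh)
      show "norm (transpose B *v (q (Suc k) - q k)) \<le> nB * e"
        unfolding e_def by (rule norm_transpose_mult_le)
      have "norm (transpose B *v (B *v (v (Suc k) - v k))) \<le> nB * (nB * dv k)"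
        using nonneg by (intro order_trans[OF norm_transpose_mult_le] mult_left_mono onorm) auto
      then show "norm (\<gamma> *\<^sub>R (transpose B *v (B *v (v (Suc k) - v k)))) \<le> \<gamma> * nB\<^sup>2 * dv k"
        using gamma(1) by (simp add: power2_eq_square mult.assoc)
    qed
    have z: "norm (r (Suc k)) = 1 / \<gamma> * dp k"
      using gamma(1) by (simp add: p_eq)
    have "norm (x, y, r (Suc k)) \<le> norm x + (norm y + norm (r (Suc k)))"
      using norm_Pair_le[of x "(y, r (Suc k))"] norm_Pair_le[of y "r (Suc k)"] by linarith
    also have "\<dots> \<le> (2 * L_G + Q * L_Omega + E * L_K) * du k + (2 * L_G + L_H + \<gamma> * nB\<^sup>2) * dv k
        + (L_Theta + nB) * e + 1 / \<gamma> * dp k"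
      using x y unfolding z by (simp add: algebra_simps)
    also have "\<dots> \<le> C * du k + C * dv k + C * e + C * dp k"
    proof -
      have "0 \<le> Q * L_Omega" "0 \<le> E * L_K" "0 \<le> \<gamma> * nB\<^sup>2" "0 \<le> 1 / \<gamma>"
        using nonneg by simp_all
      with nonneg have "2 * L_G + Q * L_Omega + E * L_K \<le> C" "2 * L_G + L_H + \<gamma> * nB\<^sup>2 \<le> C"
        "L_Theta + nB \<le> C" "1 / \<gamma> \<le> C"
        unfolding C_def by linarith+
      then show ?thesis by (intro add_mono mult_right_mono) (simp_all add: e_def)
    qed
    finally have *: "norm (x, y, r (Suc k)) \<le> C * (du k + dv k + e + dp k)" by (simp add: distrib_left)
    have "edist 0 (al_subdiff G J H \<Theta> B U \<gamma> (u (Suc k), v (Suc k), p (Suc k)))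
        \<le> ereal (norm (x, y, r (Suc k)))"
      unfolding edist_def using INF_lower[OF mem, of "\<lambda>z. ereal (dist 0 z)"] by (simp only: dist_0_norm)
    also have "\<dots> \<le> ereal (C * (du k + dv k + e + dp k))" using * by (simp only: ereal_less_eq)
    finally show ?thesis unfolding e_def .
  qed
  moreover have "0 \<le> C" unfolding C_def using nonneg by (intro add_nonneg_nonneg) auto
  ultimately show ?thesis using that by blast
qed

section \<open>The rate\<close>

lemma min_residual_smallo:
  "(\<forall>\<^sub>F k in sequentially.
      (MIN j\<in>{1..k}. edist 0 (al_subdiff G J H \<Theta> B U \<gamma> (u j, v j, p j))) < \<infinity>) \<and>
   (\<lambda>k. real_of_ereal (MIN j\<in>{1..k}. edist 0 (al_subdiff G J H \<Theta> B U \<gamma> (u j, v j, p j))))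
     \<in> o(\<lambda>k. 1 / sqrt (real k))"
proof -
  obtain C where C: "0 \<le> C" "\<And>k. edist 0 (al_subdiff G J H \<Theta> B U \<gamma> (u (Suc k), v (Suc k), p (Suc k)))
    \<le> ereal (C * (du k + dv k + norm (q (Suc k) - q k) + dp k))"
    using edist_subdiff_bound by blast
  \<comment> \<open>The residual at index \<open>j\<close> involves increments at
    \<open>j - 1\<close> and, through \<open>q\<close>, the multiplier increment at
    \<open>j - 2\<close>. Truncated subtraction below 2 does no harm, as the bound is claimed from 2
    on. The 4 comes from squaring four terms, the 9 from \<open>3 * dp (Suc k)\<close>: two copies
    from the extrapolated \<open>q\<close> and one from the constraint residual.\<close>
  define b where "b k = C\<^sup>2 * (4 * ((du (k - 1))\<^sup>2 + (dv (k - 1))\<^sup>2 + 9 * (dp (k - 1))\<^sup>2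
    + (dp (k - 2))\<^sup>2))" for k
  have "summable (\<lambda>k. (du (Suc k))\<^sup>2)" using summable_sq_du by (subst summable_Suc_iff)
  moreover have "summable (\<lambda>k. (dv (Suc k))\<^sup>2)" using summable_sq_dv by (subst summable_Suc_iff)
  moreover have "summable (\<lambda>k. (dp (Suc k))\<^sup>2)" using summable_sq_dp by (subst summable_Suc_iff)
  moreover have "b (Suc (Suc k)) = C\<^sup>2 * (4 * ((du (Suc k))\<^sup>2 + (dv (Suc k))\<^sup>2
    + 9 * (dp (Suc k))\<^sup>2 + (dp k)\<^sup>2))" for k by (simp add: b_def)
  ultimately have "summable (\<lambda>k. b (Suc (Suc k)))"
    by (simp only:) (intro summable_mult summable_add summable_sq_dp)
  then have "summable b" by (simp only: summable_Suc_iff[of b] summable_Suc_iff[of "\<lambda>k. b (Suc k)"])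
  moreover have "edist 0 (al_subdiff G J H \<Theta> B U \<gamma> (u j, v j, p j)) \<le> ereal (sqrt (b j))"
    if "2 \<le> j" for j
  proof -
    obtain k where j: "j = Suc (Suc k)" using le_Suc_ex[OF \<open>2 \<le> j\<close>] by auto
    have "q (Suc (Suc k)) - q (Suc k) = 2 *\<^sub>R (p (Suc (Suc k)) - p (Suc k)) - (p (Suc k) - p k)"
      unfolding q_Suc by (simp add: algebra_simps)
    also have "norm \<dots> \<le> 2 * dp (Suc k) + dp k"
      by (intro order_trans[OF norm_triangle_ineq4]) simp
    finally have "C * (du (Suc k) + dv (Suc k) + norm (q (Suc (Suc k)) - q (Suc k)) + dp (Suc k))
        \<le> C * (du (Suc k) + dv (Suc k) + 3 * dp (Suc k) + dp k)"
      using C(1) by (intro mult_left_mono) auto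
    also have "\<dots> \<le> sqrt (b j)"
    proof (rule real_le_rsqrt)
      have "(C * (du (Suc k) + dv (Suc k) + 3 * dp (Suc k) + dp k))\<^sup>2
          \<le> C\<^sup>2 * (4 * ((du (Suc k))\<^sup>2 + (dv (Suc k))\<^sup>2 + (3 * dp (Suc k))\<^sup>2 + (dp k)\<^sup>2))"
        unfolding power_mult_distrib[of C] by (intro mult_left_mono four_sum_power2_le) auto
      then show "(C * (du (Suc k) + dv (Suc k) + 3 * dp (Suc k) + dp k))\<^sup>2 \<le> b j"
        by (simp add: b_def j power_mult_distrib)
    qed
    finally show ?thesis using C(2)[of "Suc k"] unfolding j by (meson ereal_less_eq(3) order_trans)
  qed
  moreover have "0 \<le> edist 0 (al_subdiff G J H \<Theta> B U \<gamma> (u j, v j, p j))" for j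
    unfolding edist_def by (intro INF_greatest) simp
  moreover have "0 \<le> b j" for j by (simp add: b_def)
  ultimately show ?thesis by (intro running_Min_smallo_inverse_sqrt[of _ b 2])
qed

end

text \<open>\<open>real_of_ereal\<close> maps \<infinity> to 0, so the little-o clause alone could
  hold with infinite distances; the eventual finiteness clause rules this out. At
  \<open>k = 0\<close> the index set of the minimum is empty, which does not affect the asymptotic
  claims.\<close>

theorem proposition4p1:
  fixes G :: "(real^'n) \<times> (real^'d) \<Rightarrow> real"
    and J :: "real^'n \<Rightarrow> ereal"
    and H :: "real^'d \<Rightarrow> real"
    and \<Theta> \<Omega> \<Phi> :: "real^'n \<Rightarrow> real^'m"
    and B :: "real^'d^'m"
    and U :: "(real^'n) set"
    and K :: "real^'n \<Rightarrow> real"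
    and L_G L_H L_Theta L_Omega L_K \<beta> \<gamma> \<sigma> :: real
    and L_Omega_comp :: "'m \<Rightarrow> real"
    and \<delta> \<epsilon> :: "nat \<Rightarrow> real"
    and u :: "nat \<Rightarrow> real^'n" and v :: "nat \<Rightarrow> real^'d" and p q :: "nat \<Rightarrow> real^'m"
  assumes U: "U \<noteq> {}" "closed U" "convex U"
    and Theta: "\<Theta> = (\<lambda>x. \<Omega> x + \<Phi> x)"
    and Omega_diff: "\<Omega> differentiable_on UNIV"
    and Phi_diff: "\<Phi> differentiable_on UNIV"
    and H1: "G differentiable_on UNIV" "L_G-lipschitz_on UNIV (grad G)"
    and H2: "H differentiable_on UNIV" "L_H-lipschitz_on UNIV (grad H)"
    and H3: "proper J" "lower_semicontinuous J"
      "U = UNIV \<Longrightarrow> convex (eff_dom J)"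
      "U \<noteq> UNIV \<Longrightarrow> \<forall>x \<in> eff_dom J \<inter> U. locally_lipschitz_around J x"
    and H4: "L_Theta-lipschitz_on UNIV \<Theta>"
    and H5: "\<And>j. (L_Omega_comp j)-lipschitz_on UNIV (grad (\<lambda>x. \<Omega> x $ j))"
      "L_Omega = (\<Sum>j\<in>UNIV. L_Omega_comp j)"
    and H6: "CARD('d) \<le> CARD('m)" "rank B = CARD('d)" "range \<Theta> \<subseteq> range ((*v) B)"
    and H7: "\<exists>c::real. \<forall>z \<in> {(x, y). \<Theta> x + B *v y = 0}. ereal c \<le> objective G J H z"
      "coercive_on {(x, y). \<Theta> x + B *v y = 0} (objective G J H)"
    and K: "K differentiable_on UNIV" "\<beta> > 0" "strongly_convex \<beta> K"
      "L_K-lipschitz_on UNIV (grad K)"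
    and gamma: "\<gamma> > 0"
      "\<gamma> > (sqrt 57 + 1) / (2 * lambda_min (transpose B ** B)) * (L_G + L_H)"
    and sigma: "0 < \<sigma>" "\<sigma> < 1"
    and alg: "napp_al G J H \<Omega> \<Phi> B U K \<gamma> \<sigma> \<delta> \<epsilon> q u v p"
    and delta: "\<And>k. \<delta> k = \<beta> * inverse
      (L_G + norm (q k) * L_Omega + \<gamma> * L_Theta\<^sup>2
       + 14 * \<gamma> * (onorm ((*v) B))\<^sup>2 * L_Theta\<^sup>2 / lambda_min (transpose B ** B)
       + 14 * (L_G + \<gamma> * onorm ((*v) B) * L_Theta)\<^sup>2 / (\<gamma> * lambda_min (transpose B ** B))
       + 1)"
  shows "(\<forall>\<^sub>F k in sequentially.
            (MIN j\<in>{1..k}. edist 0 (al_subdiff G J H \<Theta> B U \<gamma> (u j, v j, p j))) < \<infinity>) \<and>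
         (\<lambda>k. real_of_ereal (MIN j\<in>{1..k}. edist 0 (al_subdiff G J H \<Theta> B U \<gamma> (u j, v j, p j))))
           \<in> o(\<lambda>k. 1 / sqrt (real k))"
proof -
  interpret napp_run G J H \<Theta> \<Omega> \<Phi> B U K L_G L_H L_Theta L_Omega L_K \<beta> \<gamma> \<sigma> L_Omega_comp \<delta> \<epsilon> u v p q
  proof
    show "locally_lipschitz_around J x" if "U \<noteq> UNIV" "x \<in> eff_dom J \<inter> U" for x
      using H3(4) that by blast
    show "inj ((*v) B)" using H6(2) by (simp only: full_rank_injective)
  qed (use U Theta Omega_diff Phi_diff H1 H2 H3(1) H4 H5 H6(3) H7 K gamma sigma alg delta
      in \<open>auto simp only: differentiable_on_def UNIV_I\<close>)
  show ?thesis by (rule min_residual_smallo)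
qed

end
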